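(* Let $I_{SU(3)}(t)$ denote the $SU(3)$ BMN index at equal fugacities $a=b=c=t^2$, $|t|<1$ (the contour integral $I_{SU(N)}$ defined in the context, with $N=3$). Then $$I_{SU(3)}(t)=P(t)\,\frac{(1-t^2)^5(1-t^4)^3}{(1-t^8)^3(1-t^{10})^2(1-t^{12})(1-t^{14})^3(1-t^{18})},$$ where $$\begin{aligned}P(t)=\;&1+5t^2+24t^4+82t^6+245t^8+628t^{10}+1444t^{12}+3013t^{14}+5806t^{16}+10431t^{18}\\ &+17628t^{20}+28174t^{22}+42820t^{24}+62104t^{26}+86268t^{28}+115035t^{30}+147595t^{32}\\ &+182506t^{34}+217831t^{36}+251223t^{38}+280233t^{40}+302516t^{42}+316224t^{44}+320131t^{46}\\ &+313920t^{48}+298116t^{50}+274103t^{52}+243875t^{54}+209819t^{56}+174384t^{58}+139852t^{60}\\ &+108049t^{62}+80282t^{64}+57228t^{66}+39035t^{68}+25393t^{70}+15687t^{72}+9153t^{74}+5013t^{76}\\ &+2553t^{78}+1197t^{80}+507t^{82}+189t^{84}+60t^{86}+15t^{88}+3t^{90}.\end{aligned}$$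
   Context: For $N\ge 2$ and complex fugacities $|a|,|b|,|c|<1$, the BMN index of $SU(N)$ $\mathcal N=4$ SYM is $$I_{SU(N)}=\frac{\kappa^{N-1}}{N!}\oint_{|z_1|=1}\cdots\oint_{|z_N|=1}\ \prod_{i=1}^N\frac{dz_i}{2\pi i z_i}\ \prod_{\substack{1\le i,j\le N\\ i\ne j}}\frac{\left(1-\frac{z_i}{z_j}\right)\left(1-ab\frac{z_i}{z_j}\right)\left(1-bc\frac{z_i}{z_j}\right)\left(1-ca\frac{z_i}{z_j}\right)}{\left(1-abc\frac{z_i}{z_j}\right)\left(1-a\frac{z_i}{z_j}\right)\left(1-b\frac{z_i}{z_j}\right)\left(1-c\frac{z_i}{z_j}\right)},$$ with $$\kappa=\frac{(1-ab)(1-bc)(1-ca)}{(1-abc)(1-a)(1-b)(1-c)}.$$ All contours are unit circles, oriented counterclockwise. *)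

theory Defs
  imports "HOL-Complex_Analysis.Complex_Analysis"
begin

(* The iterated contour integral over |z 1| = 1, ..., |z N| = 1, with z N innermost.
   Integration variables are indexed by 1, ..., N; f must not depend on z at any other
   index (there z has the irrelevant value 0). *)
fun torus_integral :: "nat \<Rightarrow> ((nat \<Rightarrow> complex) \<Rightarrow> complex) \<Rightarrow> complex" where
  "torus_integral 0 f = f (\<lambda>_. 0)"
| "torus_integral (Suc n) f =
     torus_integral n (\<lambda>z. contour_integral (circlepath 0 1) (\<lambda>w. f (z(Suc n := w))))"

definition bmn_factor :: "complex \<Rightarrow> complex \<Rightarrow> complex \<Rightarrow> complex \<Rightarrow> complex" where
  "bmn_factor a b c u =
     ((1 - u) * (1 - a * b * u) * (1 - b * c * u) * (1 - c * a * u)) /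
     ((1 - a * b * c * u) * (1 - a * u) * (1 - b * u) * (1 - c * u))"

definition bmn_kappa :: "complex \<Rightarrow> complex \<Rightarrow> complex \<Rightarrow> complex" where
  "bmn_kappa a b c =
     ((1 - a * b) * (1 - b * c) * (1 - c * a)) /
     ((1 - a * b * c) * (1 - a) * (1 - b) * (1 - c))"

(* Meaningful for N \<ge> 2 and fugacities a, b, c of norm less than 1. *)
definition bmn_index :: "nat \<Rightarrow> complex \<Rightarrow> complex \<Rightarrow> complex \<Rightarrow> complex" where
  "bmn_index N a b c =
     bmn_kappa a b c ^ (N - 1) / fact N *
     torus_integral N (\<lambda>z.
       (\<Prod>i\<in>{1..N}. 1 / (2 * of_real pi * \<i> * z i)) *
       (\<Prod>(i, j)\<in>{(i, j). i \<in> {1..N} \<and> j \<in> {1..N} \<and> i \<noteq> j}. bmn_factor a b c (z i / z j)))"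

end

theory Submission
  imports Defs
begin

text \<open>
  Put \<open>q = t\<^sup>2\<close>. The integrand is homogeneous of degree \<open>0\<close> in \<open>(z\<^sub>1, z\<^sub>2, z\<^sub>3)\<close>, so one integration
  is trivial and, with \<open>S(u) = f(u) f(1/u)\<close> for the factor \<open>f\<close> of the integrand, what remains is the
  constant term of \<open>S(x) S(w) S(w/x)\<close> on a two-dimensional torus. The radius of \<open>x\<close> is first decreased
  below \<open>1\<close>, so that the poles \<open>q, q\<^sup>3, qx, q\<^sup>3x\<close> of the inner integrand stay apart and the residues there
  have no pole on the contour. By the symmetry \<open>S(1/u) = S(u)\<close> the residues at \<open>qx\<close> and \<open>q\<close> are
  \<open>A(x)\<close> and \<open>A(1/x)\<close>, those at \<open>q\<^sup>3x\<close> and \<open>q\<^sup>3\<close> are \<open>B(x)\<close> and \<open>B(1/x)\<close>; substituting \<open>1/x\<close> for \<open>x\<close>,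
  the terms \<open>A(1/x)\<close> and \<open>B(1/x)\<close> contribute the same as \<open>A(x)\<close> and \<open>B(x)\<close> up to the residue at \<open>x = 1\<close>.
  The outer poles in the disc are only \<open>0, q, q\<^sup>2, q\<^sup>3\<close>, of order at most three, and the residues there
  are rational functions of \<open>q\<close>.
\<close>

text \<open>The obstacle is size. At equal fugacities the poles at q are triple, and differentiating
  the quotients directly would produce very large polynomials. The second-order coefficients are
  therefore taken from logarithmic derivatives, which add up over linear factors; values stay in
  factored form, and every closed form is confirmed by a single polynomial identity in q. The final
  denominators are products of 1 - q, powers of q and cyclotomic polynomials at q. So few outer
  poles survive because S(qx) and S(q^3 x) have the roots of S(x) shifted by powers of q: most
  factors cancel in S(x) S(qx) and S(x) S(q^3 x). What complicates the outer step is the logarithmic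
  bracket of the triple inner pole, which has double poles of its own at q, q^2 and 1.\<close>

lemma frac_simps:
  fixes a b c d :: complex
  shows "c \<noteq> 0 \<Longrightarrow> a + b / c = (a * c + b) / c" "c \<noteq> 0 \<Longrightarrow> b / c + a = (b + a * c) / c"
    "c \<noteq> 0 \<Longrightarrow> a - b / c = (a * c - b) / c" "c \<noteq> 0 \<Longrightarrow> b / c - a = (b - a * c) / c"
    "c \<noteq> 0 \<Longrightarrow> d \<noteq> 0 \<Longrightarrow> a / c + b / d = (a * d + b * c) / (c * d)"
    "c \<noteq> 0 \<Longrightarrow> d \<noteq> 0 \<Longrightarrow> a / c - b / d = (a * d - b * c) / (c * d)"
    "- (b / c) = (- b) / c"
    "a * (b / c) = (a * b) / c" "(b / c) * a = (b * a) / c" "(a / c) * (b / d) = (a * b) / (c * d)"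
    "(b / c) / d = b / (c * d)" "b / (c / d) = (b * d) / c" "(b / c) ^ n = b ^ n / c ^ n"
    "c \<noteq> 0 \<Longrightarrow> d \<noteq> 0 \<Longrightarrow> a / c = b / d \<longleftrightarrow> a * d = b * c"
    "c \<noteq> 0 \<Longrightarrow> a / c = b \<longleftrightarrow> a = b * c" "c \<noteq> 0 \<Longrightarrow> b = a / c \<longleftrightarrow> b * c = a"
  by (simp_all add: field_simps power_divide)

lemma numeral_nonzero: "numeral n \<noteq> (0::complex)"
  by simp

text \<open>Meant for \<open>simp only\<close> followed by \<open>algebra\<close>: each side becomes
  one fraction, the equation is cross-multiplied, and nonvanishing conditions split into factors.
  Nothing is distributed on the way, so products and powers stay factored until
  \<open>algebra\<close> receives a polynomial identity.\<close>

lemmas clear_denominators = frac_simps numeral_nonzero mult_eq_0_iff power_eq_0_iff neg_equal_0_iff_equal simp_thms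

subsection \<open>Circle integrals\<close>

lemma circlepath_residues:
  assumes "0 < r" "r < R" "finite P" "P \<subseteq> ball 0 r" "f holomorphic_on ball 0 R - P"
  shows "contour_integral (circlepath 0 r) f = 2 * of_real pi * \<i> * (\<Sum>p\<in>P. residue f p)"
proof -
  have "contour_integral (circlepath 0 r) f
      = 2 * pi * \<i> * (\<Sum>p\<in>P. winding_number (circlepath 0 r) p * residue f p)"
  proof (rule Residue_theorem[OF open_ball _ assms(3,5)])
    show "path_image (circlepath 0 r) \<subseteq> ball 0 R - P"
      using assms by auto
    show "\<forall>z. z \<notin> ball 0 R \<longrightarrow> winding_number (circlepath 0 r) z = 0"
    proof (intro allI impI)
      fix z :: complex assume z: "z \<notin> ball 0 R"
      show "winding_number (circlepath 0 r) z = 0"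
        by (rule winding_number_zero_outside[of _ "cball 0 r"]) (use z assms in auto)
    qed
  qed auto
  also have "(\<Sum>p\<in>P. winding_number (circlepath 0 r) p * residue f p) = (\<Sum>p\<in>P. residue f p)"
  proof (rule sum.cong)
    fix p assume "p \<in> P"
    then have "norm (p - 0) < r"
      using assms by auto
    then show "winding_number (circlepath 0 r) p * residue f p = residue f p"
      by (simp add: winding_number_circlepath)
  qed simp
  finally show ?thesis by simp
qed

lemma contour_integral_circlepath_cong:
  assumes "\<And>z. norm z = r \<Longrightarrow> f z = g z" "0 \<le> r"
  shows "contour_integral (circlepath 0 r) f = contour_integral (circlepath 0 r) g"
  by (rule contour_integral_eq) (use assms in auto)

text \<open>Multiplication by a unit only moves the starting point of the circle. The integrand g is
  arbitrary, so it may itself be a contour integral whose regularity has not been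
  established.\<close>

lemma contour_integral_circlepath_rotate:
  assumes c: "norm c = 1"
  shows "contour_integral (circlepath 0 1) g
       = contour_integral (circlepath 0 1) (\<lambda>x. c * g (c * x))"
proof -
  obtain t where t: "0 \<le> t" "t < 2 * pi" and ct: "c = cis t"
    by (metis (no_types, lifting) Arg2pi_eq_0 Arg2pi_ge_0 Arg2pi_lt_2pi Arg2pi_eq cis_conv_exp assms mult_1 of_real_1)
  define a where "a = t / (2 * pi)"
  have a: "a \<in> {0..1}" and ca: "c = exp (2 * of_real pi * \<i> * of_real a)"
    using t ct by (auto simp: a_def field_simps cis_conv_exp)
  have eq: "(\<lambda>x. c * x) \<circ> circlepath 0 1 = (\<lambda>s. exp (2 * of_real pi * \<i> * of_real (a + s)))"
    by (auto simp: circlepath ca exp_add[symmetric] algebra_simps)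
  have sh: "shiftpath a (circlepath 0 1) s = exp (2 * of_real pi * \<i> * of_real (a + s))" for s
    by (auto simp: shiftpath_def circlepath algebra_simps exp_diff exp_add)
  have "contour_integral (circlepath 0 1) g = contour_integral (shiftpath a (circlepath 0 1)) g"
    by (rule contour_integral_shiftpath[symmetric]) (use a in auto)
  also have "shiftpath a (circlepath 0 1) = (\<lambda>x. c * x) \<circ> circlepath 0 1"
    using eq sh by auto
  also have "contour_integral \<dots> g = contour_integral (circlepath 0 1) (\<lambda>w. deriv (\<lambda>x. c * x) w * g (c * w))"
    by (rule contour_integral_comp_analyticW[of _ UNIV]) (auto intro!: analytic_intros)
  finally show ?thesis by simp
qed

text \<open>The form dx/x changes sign under inversion and the image circle is reversed; the two
  signs cancel.\<close>

lemma contour_integral_circlepath_inverse: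
  assumes r: "0 < r"
  shows "contour_integral (circlepath 0 r) (\<lambda>x. g (1 / x) / x)
       = contour_integral (circlepath 0 (1 / r)) (\<lambda>x. g x / x)"
proof -
  let ?c = "circlepath 0 (1 / r)"
  have "reversepath (circlepath 0 r) = inverse \<circ> ?c"
    by (rule ext) (use r in \<open>simp add: reversepath_def circlepath algebra_simps exp_diff exp_minus\<close>)
  moreover have "contour_integral (inverse \<circ> ?c) (\<lambda>x. g (1 / x) / x)
      = contour_integral ?c (\<lambda>w. deriv inverse w * (g (1 / inverse w) / inverse w))"
    by (rule contour_integral_comp_analyticW[of _ "-{0}"]) (use r in \<open>auto intro!: analytic_intros\<close>)
  moreover have "\<dots> = contour_integral ?c (\<lambda>w. - (g w / w))"
  proof (rule contour_integral_circlepath_cong)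
    fix w :: complex assume "norm w = 1 / r"
    then have "w \<noteq> 0" using r by auto
    then show "deriv inverse w * (g (1 / inverse w) / inverse w) = - (g w / w)"
      by (simp add: divide_simps power2_eq_square)
  qed (use r in auto)
  moreover have "\<dots> = - contour_integral ?c (\<lambda>w. g w / w)"
    by (simp add: contour_integral_neg)
  moreover have "contour_integral (reversepath (circlepath 0 r)) (\<lambda>x. g (1 / x) / x)
      = - contour_integral (circlepath 0 r) (\<lambda>x. g (1 / x) / x)"
    by (simp add: contour_integral_reversepath)
  ultimately show ?thesis by simp
qed

lemma contour_integral_circlepath_radius:
  assumes r: "0 < r" "r \<le> 1" and hol: "f holomorphic_on S" "open S"
    and S: "\<And>x. r \<le> norm x \<Longrightarrow> norm x \<le> 1 \<Longrightarrow> x \<in> S"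
  shows "contour_integral (circlepath 0 1) f = contour_integral (circlepath 0 r) f"
proof (rule Cauchy_theorem_homotopic_loops[OF _ hol(2) hol(1)])
  show "homotopic_loops S (circlepath 0 1) (circlepath 0 r)"
  proof (rule homotopic_loops_linear)
    fix t :: real
    let ?e = "exp (2 * of_real pi * \<i> * of_real t) :: complex"
    have 1: "norm ?e = 1"
      by (simp add: norm_exp_eq_Re)
    show "closed_segment (circlepath 0 1 t) (circlepath 0 r t) \<subseteq> S"
    proof
      fix x assume "x \<in> closed_segment (circlepath 0 1 t) (circlepath 0 r t)"
      then obtain u where u: "0 \<le> u" "u \<le> 1" "x = (1 - u) *\<^sub>R ?e + u *\<^sub>R (of_real r * ?e)"
        by (auto simp: closed_segment_def circlepath)
      then have x: "x = of_real (1 - u + u * r) * ?e"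
        by (simp add: scaleR_conv_of_real algebra_simps)
      have "norm x = \<bar>1 - u + u * r\<bar>"
        by (simp only: x norm_mult norm_of_real 1 mult_1_right)
      moreover have "u * (1 - r) \<le> 1 * (1 - r)" "0 \<le> u * (1 - r)"
        using u r by (auto intro: mult_right_mono[of u 1 "1 - r", simplified])
      then have "r \<le> 1 - u + u * r" "1 - u + u * r \<le> 1"
        by (auto simp: algebra_simps)
      ultimately show "x \<in> S"
        using r by (intro S) auto
    qed
  qed auto
qed auto

subsection \<open>Second-order jets and residues at poles of order at most three\<close>

text \<open>Stated through a power series so that analyticity at p is included and products and
  inverses reduce to coefficient arithmetic. Three coefficients suffice for poles of order at most
  three.\<close>

definition jet :: "(complex \<Rightarrow> complex) \<Rightarrow> complex \<Rightarrow> complex \<Rightarrow> complex \<Rightarrow> complex \<Rightarrow> bool" where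
  "jet f p a0 a1 a2 \<longleftrightarrow>
     (\<exists>F. (\<lambda>z. f (p + z)) has_fps_expansion F \<and>
       fps_nth F 0 = a0 \<and> fps_nth F 1 = a1 \<and> fps_nth F 2 = a2)"

lemma jet_eq: "jet f p a0 a1 a2 \<Longrightarrow> a0 = b0 \<Longrightarrow> a1 = b1 \<Longrightarrow> a2 = b2 \<Longrightarrow> jet f p b0 b1 b2"
  by simp

lemma jet_const: "jet (\<lambda>_. c) p c 0 0"
  unfolding jet_def by (rule exI[of _ "fps_const c"]) (auto simp: numeral_2_eq_2)

lemma jet_linear: "jet (\<lambda>x. \<alpha> + \<beta> * x) p (\<alpha> + \<beta> * p) \<beta> 0"
  unfolding jet_def
proof (intro exI conjI)
  show "(\<lambda>z. \<alpha> + \<beta> * (p + z)) has_fps_expansion fps_const (\<alpha> + \<beta> * p) + fps_const \<beta> * fps_X"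
    by (rule has_fps_expansion_schematicI, (rule fps_expansion_intros)+)
       (simp add: algebra_simps fps_const_add[symmetric] fps_const_mult[symmetric] del: fps_const_add fps_const_mult)
qed auto

lemma jet_add:
  assumes "jet f p a0 a1 a2" "jet g p b0 b1 b2"
  shows "jet (\<lambda>x. f x + g x) p (a0 + b0) (a1 + b1) (a2 + b2)"
proof -
  obtain F G where "(\<lambda>z. f (p + z)) has_fps_expansion F" "(\<lambda>z. g (p + z)) has_fps_expansion G"
    "fps_nth F 0 = a0" "fps_nth F 1 = a1" "fps_nth F 2 = a2"
    "fps_nth G 0 = b0" "fps_nth G 1 = b1" "fps_nth G 2 = b2"
    using assms unfolding jet_def by blast
  then show ?thesis
    unfolding jet_def by (intro exI[of _ "F + G"]) (auto intro!: fps_expansion_intros)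
qed

lemma jet_mult:
  assumes "jet f p a0 a1 a2" "jet g p b0 b1 b2"
  shows "jet (\<lambda>x. f x * g x) p (a0 * b0) (a0 * b1 + a1 * b0) (a0 * b2 + a1 * b1 + a2 * b0)"
proof -
  obtain F G where "(\<lambda>z. f (p + z)) has_fps_expansion F" "(\<lambda>z. g (p + z)) has_fps_expansion G"
    "fps_nth F 0 = a0" "fps_nth F 1 = a1" "fps_nth F 2 = a2"
    "fps_nth G 0 = b0" "fps_nth G 1 = b1" "fps_nth G 2 = b2"
    using assms unfolding jet_def by blast
  then show ?thesis
    unfolding jet_def
    by (intro exI[of _ "F * G"])
       (auto intro!: fps_expansion_intros simp: fps_mult_nth numeral_2_eq_2)
qed

lemma jet_inverse:
  assumes "jet f p a0 a1 a2" "a0 \<noteq> 0"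
  shows "jet (\<lambda>x. inverse (f x)) p (1 / a0) (- a1 / a0 ^ 2) (a1 ^ 2 / a0 ^ 3 - a2 / a0 ^ 2)"
proof -
  obtain F where F: "(\<lambda>z. f (p + z)) has_fps_expansion F"
    "fps_nth F 0 = a0" "fps_nth F 1 = a1" "fps_nth F 2 = a2"
    using assms unfolding jet_def by blast
  have e: "F * inverse F = 1"
    using F assms by (simp add: inverse_mult_eq_1')
  have g0: "fps_nth (inverse F) 0 = 1 / a0"
    using F by (simp add: inverse_eq_divide)
  have "fps_nth (F * inverse F) 1 = 0"
    by (subst e) simp
  then have g1: "fps_nth (inverse F) 1 = - a1 / a0 ^ 2"
    using F assms(2) g0 by (simp add: fps_mult_nth field_simps power2_eq_square eq_neg_iff_add_eq_0)
  have "fps_nth (F * inverse F) 2 = 0"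
    by (subst e) simp
  then have "a0 * fps_nth (inverse F) 2 + a1 * fps_nth (inverse F) 1 + a2 * fps_nth (inverse F) 0 = 0"
    using F by (simp add: fps_mult_nth numeral_2_eq_2 algebra_simps)
  then have "a0 * fps_nth (inverse F) 2 = a1 ^ 2 / a0 ^ 2 - a2 / a0"
    unfolding g1 g0 by (simp add: algebra_simps power2_eq_square eq_diff_eq add_eq_0_iff)
  then have "fps_nth (inverse F) 2 = a1 ^ 2 / a0 ^ 3 - a2 / a0 ^ 2"
    using assms(2) by (simp add: field_simps power2_eq_square power3_eq_cube)
  with F g0 g1 show ?thesis
    unfolding jet_def using assms(2)
    by (intro exI[of _ "inverse F"]) (auto intro!: fps_expansion_intros)
qed

text \<open>The second coefficient stays existential: the residues at q and 1 of the first outer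
  integrand involve only values and first derivatives of the functions treated this way.\<close>

lemma jet_of_derivative:
  assumes "f analytic_on {p}" "(f has_field_derivative a1) (at p)"
  shows "\<exists>a2. jet f p (f p) a1 a2"
proof -
  have an: "(\<lambda>z. f (p + z)) analytic_on {0}"
    using assms(1) by (auto intro!: analytic_intros analytic_on_compose_gen[of "\<lambda>z. p + z" _ f, unfolded o_def])
  then have F: "(\<lambda>z. f (p + z)) has_fps_expansion fps_expansion (\<lambda>z. f (p + z)) 0"
    by (rule analytic_at_imp_has_fps_expansion_0)
  have "((\<lambda>z. f (p + z)) has_field_derivative a1) (at 0)"
    using assms(2) by (auto simp: DERIV_shift[of f a1 0 p, symmetric] add.commute)
  then have "fps_nth (fps_expansion (\<lambda>z. f (p + z)) 0) 1 = a1"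
    by (simp add: fps_expansion_def DERIV_imp_deriv)
  then show ?thesis
    unfolding jet_def using F by (auto simp: fps_expansion_def)
qed

lemma eventually_at_finite:
  assumes "finite A" "\<And>x. x \<notin> A \<Longrightarrow> P x"
  shows "eventually P (at (p :: complex))"
proof -
  have "eventually (\<lambda>x. x \<in> UNIV - (A - {p})) (at p)"
    using assms(1) by (intro eventually_at_in_open') (auto intro: open_Diff finite_imp_closed)
  then have "eventually (\<lambda>x. x \<notin> A) (at p)"
    using eventually_neq_at_within[of p p UNIV] by eventually_elim auto
  then show ?thesis
    by (rule eventually_mono) (use assms(2) in auto)
qed

text \<open>Equality off a finite set is the right condition for reduced integrands, which can
  differ from the originals at cancelled zeros, where division by zero yields 0.\<close>

lemma residue_from_fps:
  assumes F: "(\<lambda>z. g (p + z)) has_fps_expansion F"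
    and eq: "finite A" "\<And>x. x \<notin> A \<Longrightarrow> f x = g x / (x - p) ^ Suc n"
  shows "residue f p = fps_nth F n"
proof -
  have "(\<lambda>z. g (p + z) / z ^ Suc n) has_laurent_expansion fps_to_fls F / fls_X ^ Suc n"
    by (intro laurent_expansion_intros has_laurent_expansion_fps F)
  then have "residue (\<lambda>z. g (p + z) / z ^ Suc n) 0 = fls_residue (fps_to_fls F / fls_X ^ Suc n)"
    by (rule has_laurent_expansion_residue_0)
  moreover have "residue f p = residue (\<lambda>x. g x / (x - p) ^ Suc n) p"
    by (rule residue_cong[OF eventually_at_finite[OF eq]]) simp_all
  moreover have "\<dots> = residue (\<lambda>z. g (p + z) / z ^ Suc n) 0"
    by (subst residue_shift_0) simp
  moreover have "fls_residue (fps_to_fls F / fls_X ^ Suc n) = fps_nth F n"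
    unfolding fls_X_power_conv_shift_1 by (simp add: fls_divide_shift_denom_nonzero)
  ultimately show ?thesis by simp
qed

lemma residue_eq_0_finite:
  assumes g: "g analytic_on {p}" and eq: "finite A" "\<And>x. x \<notin> A \<Longrightarrow> f x = g x"
  shows "residue f p = 0"
proof -
  have "residue f p = residue g p"
    by (rule residue_cong[OF eventually_at_finite[OF eq]]) simp_all
  also obtain S where "open S" "p \<in> S" "g holomorphic_on S"
    using g by (auto simp: analytic_on_holomorphic)
  then have "residue g p = 0"
    by (intro residue_holo)
  finally show ?thesis .
qed

lemma residue_pole1:
  assumes g: "g analytic_on {p}" and eq: "finite A" "\<And>x. x \<notin> A \<Longrightarrow> f x = g x / (x - p)"
  shows "residue f p = g p"
proof -
  have an: "(\<lambda>z. g (p + z)) analytic_on {0}"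
    using g by (auto intro!: analytic_intros analytic_on_compose_gen[of "\<lambda>z. p + z" _ g, unfolded o_def])
  have "residue f p = fps_nth (fps_expansion (\<lambda>z. g (p + z)) 0) 0"
    by (rule residue_from_fps[OF analytic_at_imp_has_fps_expansion_0[OF an] eq(1)]) (use eq(2) in auto)
  then show ?thesis
    by (simp add: fps_expansion_def)
qed

lemma residue_pole2:
  assumes "jet g p a0 a1 a2" "finite A" "\<And>x. x \<notin> A \<Longrightarrow> f x = g x / (x - p) ^ 2"
  shows "residue f p = a1"
  using assms residue_from_fps[of g p _ A f 1] unfolding jet_def
  by (auto simp: numeral_2_eq_2)

lemma residue_pole3:
  assumes "jet g p a0 a1 a2" "finite A" "\<And>x. x \<notin> A \<Longrightarrow> f x = g x / (x - p) ^ 3"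
  shows "residue f p = a2"
  using assms residue_from_fps[of g p _ A f 2] unfolding jet_def
  by (auto simp: eval_nat_numeral)

text \<open>Here \<open>a\<close> is the value at \<open>p\<close> of the Euler derivative
  \<open>x f'(x) / f(x)\<close>; for a product of linear factors \<open>(\<alpha> + \<beta> x)\<^sup>m\<close>
  the parameters \<open>a\<close> and \<open>b\<close> are the sums of \<open>m s\<close> and \<open>m s\<^sup>2\<close>, where
  \<open>s = \<beta> p / (\<alpha> + \<beta> p)\<close>.\<close>

definition logjet :: "(complex \<Rightarrow> complex) \<Rightarrow> complex \<Rightarrow> complex \<Rightarrow> complex \<Rightarrow> complex \<Rightarrow> bool" where
  "logjet f p v a b \<longleftrightarrow> p \<noteq> 0 \<and> jet f p v (v * a / p) (v * (a ^ 2 - b) / (2 * p ^ 2))"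

lemma logjet_const: "p \<noteq> 0 \<Longrightarrow> logjet (\<lambda>_. c) p c 0 0"
  unfolding logjet_def using jet_const by simp

lemma logjet_linear:
  assumes "p \<noteq> 0" "\<alpha> + \<beta> * p \<noteq> 0"
  shows "logjet (\<lambda>x. \<alpha> + \<beta> * x) p (\<alpha> + \<beta> * p) (\<beta> * p / (\<alpha> + \<beta> * p)) ((\<beta> * p / (\<alpha> + \<beta> * p)) ^ 2)"
  unfolding logjet_def using assms by (auto intro: jet_eq[OF jet_linear])

text \<open>Both parameters are additive because f'/f = a/p and (log f)'' = -(a + b - a)/p^2 =
  -b/p^2 at p. A product of many linear factors thus never has to be expanded.\<close>

lemma logjet_mult:
  assumes "logjet f p v a b" "logjet g p w c d"
  shows "logjet (\<lambda>x. f x * g x) p (v * w) (a + c) (b + d)"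
  using assms unfolding logjet_def
  by (auto intro!: jet_eq[OF jet_mult] simp: field_simps power2_eq_square)

lemma logjet_inverse:
  assumes "logjet f p v a b" "v \<noteq> 0"
  shows "logjet (\<lambda>x. inverse (f x)) p (inverse v) (- a) (- b)"
proof -
  have p: "p \<noteq> 0" and j: "jet f p v (v * a / p) (v * (a ^ 2 - b) / (2 * p ^ 2))"
    using assms(1) unfolding logjet_def by auto
  show ?thesis
    unfolding logjet_def
  proof (intro conjI)
    show "jet (\<lambda>x. inverse (f x)) p (inverse v) (inverse v * - a / p)
            (inverse v * ((- a) ^ 2 - - b) / (2 * p ^ 2))"
      by (rule jet_eq[OF jet_inverse[OF j assms(2)]])
         (use p assms(2) in \<open>auto simp: field_simps power2_eq_square power3_eq_cube\<close>)
  qed fact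
qed

lemma logjet_divide:
  assumes "logjet f p v a b" "logjet g p w c d" "w \<noteq> 0"
  shows "logjet (\<lambda>x. f x / g x) p (v / w) (a - c) (b - d)"
  using logjet_mult[OF assms(1) logjet_inverse[OF assms(2,3)]]
  by (simp add: divide_inverse)

lemma logjet_power:
  assumes "logjet f p v a b"
  shows "logjet (\<lambda>x. f x ^ n) p (v ^ n) (of_nat n * a) (of_nat n * b)"
proof (induction n)
  case 0
  then show ?case
    using logjet_const[of p 1] assms by (simp add: logjet_def)
next
  case (Suc n)
  then show ?case
    using logjet_mult[OF assms Suc] by (simp add: algebra_simps)
qed

lemma logjet_minus_left:
  assumes "p \<noteq> 0" "\<alpha> - \<beta> * p \<noteq> 0"
  shows "logjet (\<lambda>x. \<alpha> - \<beta> * x) p (\<alpha> - \<beta> * p) (- (\<beta> * p / (\<alpha> - \<beta> * p))) ((\<beta> * p / (\<alpha> - \<beta> * p)) ^ 2)"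
  using logjet_linear[of p \<alpha> "-\<beta>"] assms by simp

lemma logjet_minus_one:
  assumes "p \<noteq> 0" "\<alpha> - p \<noteq> 0"
  shows "logjet (\<lambda>x. \<alpha> - x) p (\<alpha> - p) (- (p / (\<alpha> - p))) ((p / (\<alpha> - p)) ^ 2)"
  using logjet_linear[of p \<alpha> "-1"] assms by simp

lemma logjet_minus_right:
  assumes "p \<noteq> 0" "p - \<alpha> \<noteq> 0"
  shows "logjet (\<lambda>x. x - \<alpha>) p (p - \<alpha>) (p / (p - \<alpha>)) ((p / (p - \<alpha>)) ^ 2)"
  using logjet_linear[of p "-\<alpha>" 1] assms by simp

lemma logjet_ident:
  assumes "p \<noteq> 0"
  shows "logjet (\<lambda>x. x) p p 1 1"
  using logjet_linear[of p 0 1] assms by simp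

lemma logjet_eq: "logjet f p v a b \<Longrightarrow> v = v' \<Longrightarrow> a = a' \<Longrightarrow> b = b' \<Longrightarrow> logjet f p v' a' b'"
  by simp

lemmas logjet_intros = logjet_mult logjet_divide logjet_power logjet_minus_left logjet_minus_one
  logjet_minus_right logjet_ident

lemma residue_logjet:
  assumes "logjet g p v a b" "finite A" "\<And>x. x \<notin> A \<Longrightarrow> f x = g x / (x - p) ^ 3"
  shows "residue f p = v * (a ^ 2 - b) / (2 * p ^ 2)"
  using residue_pole3 assms unfolding logjet_def by blast

subsection \<open>The symmetrized factor and the inner residues\<close>

text \<open>The powers of u in f(u) f(1/u) are cleared; the sign comes from 1 - 1/u = -(1 - u)/u. In
  this form S is visibly regular at 0, with value 1 when q \<noteq> 0.\<close>

definition sym_factor :: "complex \<Rightarrow> complex \<Rightarrow> complex" where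
  "sym_factor q u = - ((1 - u) ^ 2 * (1 - q ^ 2 * u) ^ 3 * (u - q ^ 2) ^ 3 /
     ((1 - q ^ 3 * u) * (u - q ^ 3) * (1 - q * u) ^ 3 * (u - q) ^ 3))"

text \<open>Numerator and denominator both have degree eight, so the powers of z cancel and all
  factors become linear in w, as the logarithmic rules require.\<close>

lemma sym_factor_conv:
  assumes "z \<noteq> 0"
  shows "sym_factor q (w / z) = - ((z - w) ^ 2 * (z - q ^ 2 * w) ^ 3 * (w - q ^ 2 * z) ^ 3 /
     ((z - q ^ 3 * w) * (w - q ^ 3 * z) * (z - q * w) ^ 3 * (w - q * z) ^ 3))"
proof -
  have e: "1 - w / z = (z - w) / z" "1 - c * (w / z) = (z - c * w) / z" "w / z - c = (w - c * z) / z" for c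
    using assms by (auto simp: field_simps)
  show ?thesis
    unfolding sym_factor_def e power_divide
    using assms by (simp add: divide_simps power_def)
qed

lemma bmn_factor_pair:
  assumes "u \<noteq> 0"
  shows "bmn_factor q q q u * bmn_factor q q q (1 / u) = sym_factor q u"
proof -
  have e: "1 - 1 / u = - ((1 - u) / u)" "1 - q * q * (1 / u) = (u - q ^ 2) / u"
    "1 - q * q * q * (1 / u) = (u - q ^ 3) / u" "1 - q * (1 / u) = (u - q) / u"
    using assms by (auto simp: field_simps power2_eq_square power3_eq_cube)
  have "bmn_factor q q q (1 / u) = - ((1 - u) * (u - q ^ 2) ^ 3 / ((u - q ^ 3) * (u - q) ^ 3))"
    unfolding bmn_factor_def e using assms by (simp add: divide_simps power3_eq_cube)
  moreover have "bmn_factor q q q u = (1 - u) * (1 - q ^ 2 * u) ^ 3 / ((1 - q ^ 3 * u) * (1 - q * u) ^ 3)"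
    unfolding bmn_factor_def by (simp add: power3_eq_cube power2_eq_square mult.assoc)
  ultimately show ?thesis
    unfolding sym_factor_def by (simp add: power2_eq_square ac_simps)
qed

lemma sym_factor_inverse:
  assumes "u \<noteq> 0"
  shows "sym_factor q (1 / u) = sym_factor q u"
  using bmn_factor_pair[of u q] bmn_factor_pair[of "1 / u" q] assms by (simp add: mult.commute)

definition sing :: "complex \<Rightarrow> complex set" where
  "sing q = {q, q ^ 3, 1 / q, 1 / q ^ 3}"

text \<open>
  \<open>ell1\<close> and \<open>ell2\<close> are the logarithmic data, in the sense of \<^const>\<open>logjet\<close>, at \<open>w = q x\<close> of
  \<open>S(w/x) S(w) / w\<close> without the triple pole: \<open>ell0\<close> and \<open>ell0'\<close> collect the factors whose roots are
  multiples of \<open>x\<close>, summed up in closed form, and the other terms belong to the factors of \<open>S(w)\<close>.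
\<close>

definition ell0 :: "complex \<Rightarrow> complex" where
  "ell0 q = (1 + 2*q + 5*q^2 + 2*q^3 + 4*q^4 + q^5) / ((1 - q^4) * (1 + q + q^2))"

definition ell0' :: "complex \<Rightarrow> complex" where
  "ell0' q = (1 + 8*q + 24*q^2 + 54*q^3 + 85*q^4 + 112*q^5 + 114*q^6 + 100*q^7 + 64*q^8
     + 38*q^9 + 11*q^10 + 4*q^11) / ((1 - q^4) * (1 + q + q^2))^2"

definition ell1 :: "complex \<Rightarrow> complex \<Rightarrow> complex" where
  "ell1 q x = ell0 q - 2 * (q * x / (1 - q * x)) - 3 * (q^3 * x / (1 - q^3 * x))
     + q^4 * x / (1 - q^4 * x) + 3 * (q^2 * x / (1 - q^2 * x))
     + 3 * (x / (x - q)) - x / (x - q^2) - 3 * (x / (x - 1))"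

definition ell2 :: "complex \<Rightarrow> complex \<Rightarrow> complex" where
  "ell2 q x = ell0' q + 2 * (q * x / (1 - q * x))^2 + 3 * (q^3 * x / (1 - q^3 * x))^2
     - (q^4 * x / (1 - q^4 * x))^2 - 3 * (q^2 * x / (1 - q^2 * x))^2
     + 3 * (x / (x - q))^2 - (x / (x - q^2))^2 - 3 * (x / (x - 1))^2"

text \<open>This is \<open>residue_logjet\<close> at w = q x: the fraction is the value of the part
  coming from S(w/x)/w, up to a factor (q x)^2 that cancels against the denominator p^2 there; the
  minus sign is that of \<open>sym_factor\<close>.\<close>

definition resA :: "complex \<Rightarrow> complex \<Rightarrow> complex" where
  "resA q x = - ((1 - q)^5 * (1 - q^3)^3 / (q * (1 - q^4) * (1 - q^2)^4)) *
     sym_factor q (q * x) * ((ell1 q x)^2 - ell2 q x) / 2"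

definition resB :: "complex \<Rightarrow> complex \<Rightarrow> complex" where
  "resB q x = - ((1 - q)^3 * (1 - q^3)^2 * (1 - q^5)^3 / ((1 - q^2)^3 * (1 - q^4)^3 * (1 - q^6))) *
     sym_factor q (q^3 * x)"

text \<open>For q = 0 the poles 0, q and q^3 merge, so that value is treated separately.\<close>

locale fugacity =
  fixes q :: complex
  assumes q_nonzero: "q \<noteq> 0" and norm_q: "norm q < 1"
begin

abbreviation S :: "complex \<Rightarrow> complex" where "S \<equiv> sym_factor q"

lemma q_power_ne_1: "0 < n \<Longrightarrow> q ^ n \<noteq> 1"
  using norm_q by (metis norm_one norm_power order_less_irrefl power_less_one_iff norm_ge_zero)

lemma one_minus_q_power: "0 < n \<Longrightarrow> 1 - q ^ n \<noteq> 0"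
  using q_power_ne_1[of n] by auto

lemma one_minus_q: "1 - q \<noteq> 0"
  using q_power_ne_1[of 1] by auto

text \<open>These are the cyclotomic polynomials of index 2 to 9, each a divisor of some 1 - q^n
  with n > 0.\<close>

lemma cyclotomic_nonzero:
  "1 + q \<noteq> 0" "1 + q + q^2 \<noteq> 0" "1 + q^2 \<noteq> 0" "1 + q + q^2 + q^3 + q^4 \<noteq> 0"
  "1 - q + q^2 \<noteq> 0" "1 + q + q^2 + q^3 + q^4 + q^5 + q^6 \<noteq> 0" "1 + q^4 \<noteq> 0"
  "1 + q^3 + q^6 \<noteq> 0"
proof -
  have "1 - q^2 = (1 - q) * (1 + q)" "1 - q^3 = (1 - q) * (1 + q + q^2)"
    "1 - q^4 = (1 - q^2) * (1 + q^2)" "1 - q^5 = (1 - q) * (1 + q + q^2 + q^3 + q^4)"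
    "1 - q^6 = (1 - q^3) * (1 + q) * (1 - q + q^2)"
    "1 - q^7 = (1 - q) * (1 + q + q^2 + q^3 + q^4 + q^5 + q^6)"
    "1 - q^8 = (1 - q^4) * (1 + q^4)" "1 - q^9 = (1 - q^3) * (1 + q^3 + q^6)"
    by algebra+
  then show "1 + q \<noteq> 0" "1 + q + q^2 \<noteq> 0" "1 + q^2 \<noteq> 0" "1 + q + q^2 + q^3 + q^4 \<noteq> 0"
    "1 - q + q^2 \<noteq> 0" "1 + q + q^2 + q^3 + q^4 + q^5 + q^6 \<noteq> 0" "1 + q^4 \<noteq> 0"
    "1 + q^3 + q^6 \<noteq> 0"
    using one_minus_q_power[of 2] one_minus_q_power[of 3] one_minus_q_power[of 4]
      one_minus_q_power[of 5] one_minus_q_power[of 6] one_minus_q_power[of 7]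
      one_minus_q_power[of 8] one_minus_q_power[of 9]
    by auto
qed

lemma q_power_eq_iff: "q ^ m = q ^ n \<longleftrightarrow> m = n"
proof -
  have "norm q ^ m = norm q ^ n \<Longrightarrow> m = n"
    using norm_q q_nonzero power_strict_decreasing_iff[of "norm q" m n]
      power_strict_decreasing_iff[of "norm q" n m]
    by (metis linorder_neqE_nat order_less_irrefl zero_less_norm_iff)
  then show ?thesis
    by (metis norm_power)
qed

lemma sym_factor_holomorphic: "S holomorphic_on - sing q"
proof -
  have "(1 - q ^ 3 * u) * (u - q ^ 3) * (1 - q * u) ^ 3 * (u - q) ^ 3 \<noteq> 0" if "u \<notin> sing q" for u
    using that q_nonzero by (simp add: sing_def) (auto simp: field_simps)
  then show ?thesis
    unfolding sym_factor_def by (intro holomorphic_intros) auto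
qed

lemma finite_sing: "finite (sing q)"
  by (simp add: sing_def)

lemma sym_factor_holomorphic_compose [holomorphic_intros]:
  assumes "g holomorphic_on A" "\<And>x. x \<in> A \<Longrightarrow> g x \<notin> sing q"
  shows "(\<lambda>x. S (g x)) holomorphic_on A"
  using holomorphic_on_compose_gen[OF assms(1) sym_factor_holomorphic] assms(2)
  by (auto simp: o_def)

lemma sym_factor_analytic_compose [analytic_intros]:
  assumes "g analytic_on A" "\<And>x. x \<in> A \<Longrightarrow> g x \<notin> sing q"
  shows "(\<lambda>x. S (g x)) analytic_on A"
proof -
  have "S analytic_on - sing q"
    using sym_factor_holomorphic finite_sing
    by (subst analytic_on_open) (auto intro: finite_imp_closed)
  from analytic_on_compose_gen[OF assms(1) this] show ?thesis
    using assms(2) by (auto simp: o_def)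
qed

text \<open>The function is -S(w/z)/w with the triple pole removed. It is homogeneous of degree 2 in
  (w, z), so only its value depends on z; the terms entering \<open>ell0\<close> and
  \<open>ell0'\<close> are scale-invariant. The case z = 1 also gives the residue of S(x)/x at
  q.\<close>

lemma logjet_sym_factor_q:
  assumes z: "z \<noteq> 0"
  shows "logjet (\<lambda>w. (z - w) ^ 2 * (z - q ^ 2 * w) ^ 3 * (w - q ^ 2 * z) ^ 3 /
       ((z - q ^ 3 * w) * (w - q ^ 3 * z) * (z - q * w) ^ 3) / w) (q * z)
     ((q * z)^2 * ((1 - q)^5 * (1 - q^3)^3 / (q * (1 - q^4) * (1 - q^2)^4))) (ell0 q) (ell0' q)"
proof -
  let ?p = "q * z"
  have p0: "?p \<noteq> 0"
    using q_nonzero z by simp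
  have zf: "z - ?p = z * (1 - q)" "z - q^2 * ?p = z * (1 - q^3)" "?p - q^2 * z = z * (q - q^2)"
    "z - q^3 * ?p = z * (1 - q^4)" "?p - q^3 * z = z * (q - q^3)" "z - q * ?p = z * (1 - q^2)"
    by (simp_all add: algebra_simps eval_nat_numeral)
  have q0: "1 - q^3 \<noteq> 0" "q - q^2 \<noteq> 0" "1 - q^4 \<noteq> 0" "q - q^3 \<noteq> 0" "1 - q^2 \<noteq> 0" "1 - q \<noteq> 0"
    using one_minus_q_power[of 3] one_minus_q_power[of 4] one_minus_q_power[of 2]
      q_power_eq_iff[of 1 2] q_power_eq_iff[of 1 3] one_minus_q by auto
  have zt: "?p / (z * (1 - q)) = q / (1 - q)" "q^2 * ?p / (z * (1 - q^3)) = q^3 / (1 - q^3)"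
    "?p / (z * (q - q^2)) = q / (q - q^2)" "q^3 * ?p / (z * (1 - q^4)) = q^4 / (1 - q^4)"
    "?p / (z * (q - q^3)) = q / (q - q^3)" "q * ?p / (z * (1 - q^2)) = q^2 / (1 - q^2)"
    using z by (auto simp: eval_nat_numeral)
  have zn: "z - ?p \<noteq> 0" "z - q^2 * ?p \<noteq> 0" "?p - q^2 * z \<noteq> 0" "z - q^3 * ?p \<noteq> 0"
    "?p - q^3 * z \<noteq> 0" "z - q * ?p \<noteq> 0"
    unfolding zf using z q0 by simp_all
  show ?thesis
    \<comment> \<open>The rules compute the data as schematic values along the structure of the
      quotient; the remaining goals compare value, a and b with the closed forms.\<close>
    apply (rule logjet_eq, (rule logjet_intros p0 zn no_zero_divisors power_not_zero)+)
      apply (simp_all only: zf zt)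
    subgoal
      by (simp only: clear_denominators z q0 q_nonzero, algebra)
    subgoal
      unfolding ell0_def of_nat_numeral
      by (simp only: clear_denominators q0 cyclotomic_nonzero q_nonzero, algebra)
    subgoal
      unfolding ell0'_def of_nat_numeral
      by (simp only: clear_denominators q0 cyclotomic_nonzero q_nonzero, algebra)
    done
qed

text \<open>Two free parameters let one computation serve both triple poles: (z, y) = (x, 1) gives q
  x and (1, x) gives q, which is where the argument 1/x comes from. The seven inequalities keep
  every linear factor of S(w/y) nonzero at q z, numerators included, since logarithmic data divide
  by them.\<close>

lemma residue_triple_inner:
  assumes z: "z \<noteq> 0" and y: "y \<noteq> 0"
    and ne: "y \<noteq> q * z" "y \<noteq> q^3 * z" "y \<noteq> q^4 * z" "y \<noteq> q^2 * z"
      "z \<noteq> q * y" "z \<noteq> q^2 * y" "z \<noteq> y"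
  shows "residue (\<lambda>w. S (w / z) * S (w / y) / w) (q * z) = resA q (z / y)"
proof -
  let ?p = "q * z"
  let ?x = "z / y"
  define g1 where "g1 = (\<lambda>w. (z - w) ^ 2 * (z - q ^ 2 * w) ^ 3 * (w - q ^ 2 * z) ^ 3 /
     ((z - q ^ 3 * w) * (w - q ^ 3 * z) * (z - q * w) ^ 3) / w)"
  define g2 where "g2 = (\<lambda>w. (y - w) ^ 2 * (y - q ^ 2 * w) ^ 3 * (w - q ^ 2 * y) ^ 3 /
     ((y - q ^ 3 * w) * (w - q ^ 3 * y) * (y - q * w) ^ 3 * (w - q * y) ^ 3))"
  note nz = q_nonzero z y
  have p0: "?p \<noteq> 0"
    using nz by simp
  have yf: "y - ?p = y * (1 - q * ?x)" "y - q^2 * ?p = y * (1 - q^3 * ?x)" "?p - q^2 * y = y * (q * (?x - q))"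
    "y - q^3 * ?p = y * (1 - q^4 * ?x)" "?p - q^3 * y = y * (q * (?x - q^2))"
    "y - q * ?p = y * (1 - q^2 * ?x)" "?p - q * y = y * (q * (?x - 1))"
    using y by (simp_all add: field_simps eval_nat_numeral)
  have x0: "1 - q * ?x \<noteq> 0" "1 - q^3 * ?x \<noteq> 0" "?x - q \<noteq> 0" "1 - q^4 * ?x \<noteq> 0"
    "?x - q^2 \<noteq> 0" "1 - q^2 * ?x \<noteq> 0" "?x - 1 \<noteq> 0"
    using ne y by (auto simp: field_simps)
  have yt: "?p / (y * (1 - q * ?x)) = q * ?x / (1 - q * ?x)"
    "q^2 * ?p / (y * (1 - q^3 * ?x)) = q^3 * ?x / (1 - q^3 * ?x)"
    "?p / (y * (q * (?x - q))) = ?x / (?x - q)"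
    "q^3 * ?p / (y * (1 - q^4 * ?x)) = q^4 * ?x / (1 - q^4 * ?x)"
    "?p / (y * (q * (?x - q^2))) = ?x / (?x - q^2)"
    "q * ?p / (y * (1 - q^2 * ?x)) = q^2 * ?x / (1 - q^2 * ?x)"
    "?p / (y * (q * (?x - 1))) = ?x / (?x - 1)"
    using y q_nonzero by (auto simp: eval_nat_numeral)
  have yn: "y - ?p \<noteq> 0" "y - q^2 * ?p \<noteq> 0" "?p - q^2 * y \<noteq> 0" "y - q^3 * ?p \<noteq> 0"
    "?p - q^3 * y \<noteq> 0" "y - q * ?p \<noteq> 0" "?p - q * y \<noteq> 0"
    unfolding yf using y x0 q_nonzero by simp_all
  have j1: "logjet g1 ?p (?p^2 * ((1 - q)^5 * (1 - q^3)^3 / (q * (1 - q^4) * (1 - q^2)^4)))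
     (ell0 q) (ell0' q)"
    unfolding g1_def by (rule logjet_sym_factor_q[OF z])
  have j2: "logjet g2 ?p (- S (q * ?x)) (ell1 q ?x - ell0 q) (ell2 q ?x - ell0' q)"
    unfolding g2_def
    apply (rule logjet_eq, (rule logjet_intros p0 yn no_zero_divisors power_not_zero)+)
      apply (simp_all only: yf yt)
    subgoal
      using y sym_factor_conv[of y q ?p] unfolding yf by simp
     apply (simp add: ell1_def)
    apply (simp add: ell2_def)
    done
  have "residue (\<lambda>w. S (w / z) * S (w / y) / w) ?p
      = (?p^2 * ((1 - q)^5 * (1 - q^3)^3 / (q * (1 - q^4) * (1 - q^2)^4))) * (- S (q * ?x)) *
        ((ell0 q + (ell1 q ?x - ell0 q))^2 - (ell0' q + (ell2 q ?x - ell0' q))) / (2 * ?p^2)"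
  \<comment> \<open>No exceptional points: both sides are the same product of factors and inverses,
    so they agree even where a denominator vanishes.\<close>
  proof (rule residue_logjet[OF logjet_mult[OF j1 j2], of "{}"])
    fix w
    show "S (w / z) * S (w / y) / w = g1 w * g2 w / (w - q * z) ^ 3"
      unfolding sym_factor_conv[OF z] sym_factor_conv[OF y] g1_def g2_def by simp
  qed simp
  also have "\<dots> = resA q ?x"
    using p0 by (simp add: resA_def mult_ac)
  finally show ?thesis .
qed

lemma residue_simple_inner:
  assumes z: "z \<noteq> 0" and y: "y \<noteq> 0"
    and ne: "y \<noteq> q^2 * z" "y \<noteq> q^4 * z" "y \<noteq> q^6 * z" "z \<noteq> y"
  shows "residue (\<lambda>w. S (w / z) * S (w / y) / w) (q^3 * z) = resB q (z / y)"
proof -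
  let ?p = "q^3 * z"
  define g where "g = (\<lambda>w. - ((z - w) ^ 2 * (z - q ^ 2 * w) ^ 3 * (w - q ^ 2 * z) ^ 3 /
     ((z - q ^ 3 * w) * (z - q * w) ^ 3 * (w - q * z) ^ 3)) * S (w / y) / w)"
  have q0: "1 - q^6 \<noteq> 0" "1 - q^4 \<noteq> 0" "q^3 - q \<noteq> 0" "1 - q^2 \<noteq> 0"
    using one_minus_q_power[of 6] one_minus_q_power[of 4] one_minus_q_power[of 2]
      q_power_eq_iff[of 3 1] by auto
  have zf: "z - q^3 * ?p = z * (1 - q^6)" "z - q * ?p = z * (1 - q^4)" "?p - q * z = z * (q^3 - q)"
    by (simp_all add: algebra_simps eval_nat_numeral)
  have d: "z - q^3 * ?p \<noteq> 0" "z - q * ?p \<noteq> 0" "?p - q * z \<noteq> 0"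
    unfolding zf using z q0 by auto
  have "?p / y \<notin> sing q"
    using ne y z q_nonzero by (auto simp: sing_def field_simps eval_nat_numeral)
  then have "g analytic_on {?p}"
    unfolding g_def using d z y q_nonzero by (intro analytic_intros) auto
  then have "residue (\<lambda>w. S (w / z) * S (w / y) / w) ?p = g ?p"
    by (rule residue_pole1[of _ _ "{}"]) (simp_all add: sym_factor_conv[OF z] g_def mult_ac)
  also have "g ?p = - ((1 - q)^3 * (1 - q^3)^2 * (1 - q^5)^3 / ((1 - q^2)^3 * (1 - q^4)^3 * (1 - q^6)))
      * S (?p / y)"
  proof -
    have "- ((z - ?p) ^ 2 * (z - q ^ 2 * ?p) ^ 3 * (?p - q ^ 2 * z) ^ 3 /
        ((z - q ^ 3 * ?p) * (z - q * ?p) ^ 3 * (?p - q * z) ^ 3)) / ?p =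
        - ((1 - q)^3 * (1 - q^3)^2 * (1 - q^5)^3 / ((1 - q^2)^3 * (1 - q^4)^3 * (1 - q^6)))"
      unfolding zf by (simp only: clear_denominators z q0 q_nonzero, algebra)
    then show ?thesis
      unfolding g_def by (metis times_divide_eq_left)
  qed
  finally show ?thesis
    by (simp add: resB_def)
qed

subsection \<open>Reduction to outer residues\<close>

lemma norm_q_pos: "0 < norm q"
  using q_nonzero by simp

lemma norm_q_power_le: "0 < n \<Longrightarrow> norm (q ^ n) \<le> norm q"
  unfolding norm_power using power_decreasing[of 1 n "norm q"] norm_q by auto

lemma not_sing:
  assumes "u \<noteq> q" "u \<noteq> q ^ 3" "norm u < 1 / norm q"
  shows "u \<notin> sing q"
proof -
  have "norm q ^ 3 \<le> norm q"
    using norm_q_power_le[of 3] by (simp add: norm_power)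
  then have "1 / norm q \<le> 1 / norm q ^ 3"
    using norm_q_pos by (intro divide_left_mono) auto
  then have "norm u < norm (1 / q)" "norm u < norm (1 / q ^ 3)"
    using assms by (auto simp: norm_divide norm_power)
  then show ?thesis
    using assms(1,2) by (auto simp: sing_def)
qed

lemma not_sing_annulus:
  assumes "norm q < norm u" "norm u < 1 / norm q"
  shows "u \<notin> sing q"
  using assms norm_q_power_le[of 3] by (intro not_sing) auto

lemma less_inverse_norm: "norm u \<le> 1 \<Longrightarrow> norm u < 1 / norm q"
  using norm_q norm_q_pos less_divide_eq_1_pos[of "norm q" 1] by linarith

text \<open>The lower bound on |x| keeps x/q and x/q^3 outside the unit circle and separates q x
  from q^3; the upper bound separates q from q x. The summand 1 is the residue S(0)^2 at 0.\<close>

lemma inner_integral: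
  assumes x: "norm q < norm x" "norm x < 1"
  shows "contour_integral (circlepath 0 1) (\<lambda>w. S w * S (w / x) / w)
    = 2 * of_real pi * \<i> * (1 + resA q x + resA q (1 / x) + resB q x + resB q (1 / x))"
proof -
  let ?f = "\<lambda>w. S w * S (w / x) / w"
  let ?P = "{0, q, q ^ 3, q * x, q ^ 3 * x}"
  \<comment> \<open>The modulus of x/q, which bounds the disc free of further poles.\<close>
  define R where "R = norm x / norm q"
  have x0: "x \<noteq> 0"
    using x norm_q_pos by auto
  have xq: "x \<noteq> q ^ n" if "0 < n" for n
    using norm_q_power_le[OF that] x by auto
  have x1: "q ^ n * x \<noteq> 1" if "0 < n" for n
  proof -
    have "norm (q ^ n * x) < 1 * 1"
      unfolding norm_mult using norm_q_power_le[OF that] x norm_q by (intro mult_strict_mono) auto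
    then show ?thesis
      by auto
  qed
  have x_ne_1: "x \<noteq> 1" "1 \<noteq> x"
    using x by auto
  have "contour_integral (circlepath 0 1) ?f = 2 * of_real pi * \<i> * (\<Sum>p\<in>?P. residue ?f p)"
  proof (rule circlepath_residues)
    show "1 < R"
      unfolding R_def using x norm_q_pos by simp
    have "norm (q * x) < 1" "norm (q ^ 3 * x) < 1" "norm (q ^ 3) < 1"
      using mult_strict_mono[of "norm q" 1 "norm x" 1] mult_strict_mono[of "norm (q^3)" 1 "norm x" 1]
        x norm_q norm_q_power_le[of 3] by (auto simp: norm_mult)
    then show "?P \<subseteq> ball 0 1"
      using norm_q by auto
    show "?f holomorphic_on ball 0 R - ?P"
    proof (intro holomorphic_intros)
      fix w assume w: "w \<in> ball 0 R - ?P"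
      then have w': "norm w < R"
        by simp
      have "R \<le> 1 / norm q"
        unfolding R_def using x norm_q_pos by (intro divide_right_mono) auto
      then show "w \<notin> sing q"
        using w w' by (intro not_sing) auto
      have "norm w / norm x < 1 / norm q"
        using w' x0 norm_q_pos unfolding R_def by (simp add: field_simps)
      then show "w / x \<notin> sing q"
        using w x0 by (intro not_sing) (auto simp: norm_divide field_simps)
    qed (use x0 in auto)
  qed auto
  also have "(\<Sum>p\<in>?P. residue ?f p)
      = residue ?f 0 + residue ?f q + residue ?f (q ^ 3) + residue ?f (q * x) + residue ?f (q ^ 3 * x)"
  proof -
    have "q \<noteq> q ^ 3" "q \<noteq> q * x" "q \<noteq> q ^ 3 * x" "q ^ 3 \<noteq> q * x" "q ^ 3 \<noteq> q ^ 3 * x" "q * x \<noteq> q ^ 3 * x"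
      using q_power_eq_iff[of 1 3] xq[of 2] x1[of 2] x q_nonzero x0 one_minus_q_power[of 2]
      by (auto simp: eval_nat_numeral mult.assoc)
    then show ?thesis
      using q_nonzero x0 by (simp add: add.assoc)
  qed
  also have "residue ?f 0 = 1"
  proof -
    have "residue ?f 0 = S 0 * S (0 / x)"
    proof (rule residue_pole1[of _ _ "{}"])
      show "(\<lambda>w. S w * S (w / x)) analytic_on {0}"
        using x0 q_nonzero by (intro analytic_intros) (auto simp: sing_def)
    qed auto
    also have "\<dots> = 1"
      using q_nonzero by (simp add: sym_factor_def eval_nat_numeral)
    finally show ?thesis .
  qed
  also have "residue ?f q = resA q (1 / x)"
    using residue_triple_inner[of 1 x] x0 xq[of 1] xq[of 2] xq[of 3] xq[of 4]
      x1[of 1, symmetric] x1[of 2, symmetric] x_ne_1 by auto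
  also have "residue ?f (q ^ 3) = resB q (1 / x)"
    using residue_simple_inner[of 1 x] x0 xq[of 2] xq[of 4] xq[of 6] x_ne_1 by auto
  also have "residue ?f (q * x) = resA q x"
    using residue_triple_inner[of x 1] x0 x1[of 1, symmetric] x1[of 2, symmetric]
      x1[of 3, symmetric] x1[of 4, symmetric] xq[of 1] xq[of 2] x_ne_1
    by (auto simp: mult.commute[of "S _" "S (_ / x)"])
  also have "residue ?f (q ^ 3 * x) = resB q x"
    using residue_simple_inner[of x 1] x0 x1[of 2, symmetric] x1[of 4, symmetric] x1[of 6, symmetric] x_ne_1
    by (auto simp: mult.commute[of "S _" "S (_ / x)"])
  finally show ?thesis
    by (simp add: algebra_simps)
qed

lemma sym_factor_continuous_compose [continuous_intros]:
  assumes "continuous_on A g" "\<And>x. x \<in> A \<Longrightarrow> g x \<notin> sing q"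
  shows "continuous_on A (\<lambda>x. S (g x))"
  by (rule continuous_on_compose2[OF holomorphic_on_imp_continuous_on[OF sym_factor_holomorphic] assms(1)])
     (use assms(2) in auto)

lemma inverse_radius:
  assumes "norm q < r"
  shows "1 / r < 1 / norm q"
proof -
  have "0 < r * norm q"
    using assms norm_q_pos by (intro mult_pos_pos) linarith+
  then show ?thesis
    using divide_strict_left_mono[OF assms, of 1] by simp
qed

text \<open>On the two circles x, w and w/x all stay in the annulus between |q| and 1/|q|, where S
  has no pole; the integrand is therefore continuous and the integrals commute.\<close>

lemma kernel_swap:
  assumes r: "norm q < r" "r \<le> 1"
  shows "contour_integral (circlepath 0 r) (\<lambda>x. contour_integral (circlepath 0 1) (\<lambda>w. S x * (S w * S (w / x) / w) / x))
    = contour_integral (circlepath 0 1) (\<lambda>w. contour_integral (circlepath 0 r) (\<lambda>x. S x * (S w * S (w / x) / w) / x))"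
proof (rule contour_integral_swap)
  have r0: "0 < r"
    using r norm_q_pos by linarith
  show "continuous_on (path_image (circlepath 0 r) \<times> path_image (circlepath 0 1))
     (\<lambda>(x, w). S x * (S w * S (w / x) / w) / x)"
    unfolding case_prod_beta
  proof -
    let ?X = "path_image (circlepath 0 r) \<times> path_image (circlepath 0 1)"
    have n: "norm (fst v) = r" "norm (snd v) = 1" if "v \<in> ?X" for v
      using that r0 by auto
    have nz: "\<forall>v\<in>?X. fst v \<noteq> 0" "\<forall>v\<in>?X. snd v \<noteq> 0"
      using n r0 by fastforce+
    have sg: "fst v \<notin> sing q" "snd v \<notin> sing q" "snd v / fst v \<notin> sing q" if v: "v \<in> ?X" for v
    proof -
      show "fst v \<notin> sing q"
        using n[OF v] r by (intro not_sing_annulus less_inverse_norm) auto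
      show "snd v \<notin> sing q"
        using n[OF v] norm_q by (intro not_sing_annulus less_inverse_norm) auto
      have "norm q * r \<le> norm q * 1"
        using r norm_q_pos by (intro mult_left_mono) auto
      then have "norm q < 1 / r"
        using norm_q by (subst pos_less_divide_eq[OF r0]) linarith
      moreover have "1 / r < 1 / norm q"
        by (rule inverse_radius[OF r(1)])
      ultimately have "norm q < 1 / r \<and> 1 / r < 1 / norm q" ..
      then show "snd v / fst v \<notin> sing q"
        using n[OF v] by (intro not_sing_annulus) (auto simp: norm_divide)
    qed
    show "continuous_on ?X (\<lambda>p. S (fst p) * (S (snd p) * S (snd p / fst p) / snd p) / fst p)"
      by (intro continuous_intros sg nz)
  qed
  show "continuous_on {0..1} (\<lambda>t. vector_derivative (circlepath 0 r) (at t))"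
    "continuous_on {0..1} (\<lambda>t. vector_derivative (circlepath 0 1) (at t))"
    by (auto simp: vector_derivative_circlepath intro!: continuous_intros)
qed auto

text \<open>
  For \<open>|x| = 1\<close> the poles \<open>q\<close> and \<open>q x\<close> of the inner integrand collide at \<open>x = 1\<close>, and the single
  residues have a pole there although their sum has none. Moving the \<open>x\<close> circle requires the other
  order of integration, where the integrand is explicit.
\<close>

lemma kernel_radius:
  assumes r: "norm q < r" "r < 1"
  shows "contour_integral (circlepath 0 1) (\<lambda>x. contour_integral (circlepath 0 1) (\<lambda>w. S x * (S w * S (w / x) / w) / x))
    = contour_integral (circlepath 0 r) (\<lambda>x. contour_integral (circlepath 0 1) (\<lambda>w. S x * (S w * S (w / x) / w) / x))"
proof -
  have r0: "0 < r"
    using r norm_q_pos by linarith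
  define A where "A = {x :: complex. norm q < norm x \<and> norm x < 1 / norm q}"
  have "A = ball 0 (1 / norm q) - cball 0 (norm q)"
    by (auto simp: A_def)
  then have "open A"
    by (simp add: open_Diff)
  have "contour_integral (circlepath 0 1) (\<lambda>x. S x * (S w * S (w / x) / w) / x)
      = contour_integral (circlepath 0 r) (\<lambda>x. S x * (S w * S (w / x) / w) / x)"
    if w: "norm w = 1" for w
  proof (rule contour_integral_circlepath_radius[where S = A])
    show "(\<lambda>x. S x * (S w * S (w / x) / w) / x) holomorphic_on A"
    proof (intro holomorphic_intros)
      fix x assume x: "x \<in> A"
      then show "x \<notin> sing q" "x \<noteq> 0"
        using not_sing_annulus[of x] by (auto simp: A_def)
      show "w \<noteq> 0"
        using w by auto
      have "0 < norm x"
        using x norm_q_pos by (auto simp: A_def)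
      then have "norm q < 1 / norm x" "1 / norm x < 1 / norm q"
        using x norm_q_pos by (simp_all add: A_def field_simps)
      then show "w / x \<notin> sing q"
        using w by (intro not_sing_annulus) (auto simp: norm_divide)
    qed (auto simp: A_def)
    show "x \<in> A" if "r \<le> norm x" "norm x \<le> 1" for x
      using that r less_inverse_norm[of x] by (auto simp: A_def)
  qed (use r r0 \<open>open A\<close> in auto)
  then have "contour_integral (circlepath 0 1) (\<lambda>w. contour_integral (circlepath 0 1) (\<lambda>x. S x * (S w * S (w / x) / w) / x))
    = contour_integral (circlepath 0 1) (\<lambda>w. contour_integral (circlepath 0 r) (\<lambda>x. S x * (S w * S (w / x) / w) / x))"
    by (intro contour_integral_circlepath_cong) auto
  then show ?thesis
    using kernel_swap[of 1] kernel_swap[of r] r norm_q by simp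
qed

lemma one_minus_power_mult:
  assumes "0 < n" "norm x < 1 / norm q"
  shows "1 - q ^ n * x \<noteq> 0"
proof -
  have "norm (q ^ n * x) \<le> norm q * norm x"
    unfolding norm_mult using norm_q_power_le[OF assms(1)] by (intro mult_right_mono) auto
  also have "\<dots> < 1"
    using assms(2) norm_q_pos by (simp add: field_simps)
  finally show ?thesis
    by auto
qed

lemma outer0_holomorphic: "(\<lambda>x. S x / x) holomorphic_on ball 0 (1 / norm q) - {0, q, q ^ 3}"
  by (intro holomorphic_intros not_sing) auto

text \<open>The disc reaches beyond the unit circle because inversion turns radius r into 1/r. There
  |q x| < 1, so the only poles of S(q x) are x = 1 and x = q^2.\<close>

lemma outerA_holomorphic:
  "(\<lambda>x. S x * resA q x / x) holomorphic_on ball 0 (1 / norm q) - {0, q, q ^ 2, q ^ 3, 1}"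
proof -
  let ?D = "ball 0 (1 / norm q) - {0, q, q ^ 2, q ^ 3, 1}"
  have nz: "1 - q * x \<noteq> 0" "1 - q^2 * x \<noteq> 0" "1 - q^3 * x \<noteq> 0" "1 - q^4 * x \<noteq> 0"
    "x - q \<noteq> 0" "x - q^2 \<noteq> 0" "x - 1 \<noteq> 0" if "x \<in> ?D" for x
    using that one_minus_power_mult[of 1 x] one_minus_power_mult[of 2 x] one_minus_power_mult[of 3 x]
      one_minus_power_mult[of 4 x] by auto
  have sg: "x \<notin> sing q" "q * x \<notin> sing q" if x: "x \<in> ?D" for x
  proof -
    show "x \<notin> sing q"
      using x by (intro not_sing) auto
    have "norm (q * x) < 1"
      using x norm_q_pos by (auto simp: norm_mult field_simps)
    moreover have "q * x \<noteq> q ^ 3"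
      using x q_nonzero by (auto simp: eval_nat_numeral)
    ultimately show "q * x \<notin> sing q"
      using x q_nonzero by (intro not_sing less_inverse_norm) auto
  qed
  define K where "K = - ((1 - q)^5 * (1 - q^3)^3 / (q * (1 - q^4) * (1 - q^2)^4))"
  have "resA q = (\<lambda>x. K * S (q * x) * ((ell1 q x)^2 - ell2 q x) / 2)"
    by (simp add: resA_def K_def fun_eq_iff)
  then show ?thesis
    unfolding ell1_def ell2_def by (simp only:) (intro holomorphic_intros sg nz, auto)
qed

lemma outerB_holomorphic:
  "(\<lambda>x. S x * resB q x / x) holomorphic_on ball 0 (1 / norm q) - {0, q, q ^ 3, 1}"
proof -
  let ?D = "ball 0 (1 / norm q) - {0, q, q ^ 3, 1}"
  have sg: "x \<notin> sing q" "q ^ 3 * x \<notin> sing q" if x: "x \<in> ?D" for x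
  proof -
    show "x \<notin> sing q"
      using x by (intro not_sing) auto
    have "norm (q^3 * x) < norm q"
    proof -
      have "norm (q * x) < 1"
        using x norm_q_pos by (auto simp: norm_mult field_simps)
      then have "norm (q^2) * norm (q * x) < norm q * 1"
        using norm_q_power_le[of 2] norm_q_pos by (intro mult_le_less_imp_less) auto
      then show ?thesis
        by (simp add: norm_mult norm_power eval_nat_numeral mult_ac)
    qed
    moreover from this have "norm (q^3 * x) < 1 / norm q"
      using norm_q by (intro less_inverse_norm) auto
    moreover have "q^3 * x \<noteq> q ^ 3"
      using x q_nonzero by auto
    ultimately show "q^3 * x \<notin> sing q"
      by (intro not_sing) auto
  qed
  define K where
    "K = - ((1 - q)^3 * (1 - q^3)^2 * (1 - q^5)^3 / ((1 - q^2)^3 * (1 - q^4)^3 * (1 - q^6)))"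
  have "resB q = (\<lambda>x. K * S (q ^ 3 * x))"
    by (simp add: resB_def K_def fun_eq_iff)
  then show ?thesis
    by (simp only:) (intro holomorphic_intros sg, auto)
qed

text \<open>By S(1/x) = S(x), inversion replaces g(1/x) by g(x) at the price of the radius 1/r.
  Since 1 < 1/r < 1/|q|, the new circle encloses the point 1 but stays in the domain of
  holomorphy.\<close>

lemma circle_integral_inverse:
  assumes r: "norm q < r" "r < 1" and P: "finite P" "0 \<in> P" "P \<subseteq> ball 0 (1 / r)"
    and hol: "(\<lambda>x. S x * g x / x) holomorphic_on ball 0 (1 / norm q) - P"
  shows "contour_integral (circlepath 0 r) (\<lambda>x. S x * g (1 / x) / x)
    = 2 * of_real pi * \<i> * (\<Sum>p\<in>P. residue (\<lambda>x. S x * g x / x) p)"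
proof -
  have r0: "0 < r"
    using r norm_q_pos by linarith
  have "contour_integral (circlepath 0 r) (\<lambda>x. S x * g (1 / x) / x)
      = contour_integral (circlepath 0 r) (\<lambda>x. S (1 / x) * g (1 / x) / x)"
    by (rule contour_integral_circlepath_cong) (use r0 sym_factor_inverse in auto)
  also have "\<dots> = contour_integral (circlepath 0 (1 / r)) (\<lambda>x. S x * g x / x)"
    using contour_integral_circlepath_inverse[OF r0, of "\<lambda>x. S x * g x"] by simp
  also have "\<dots> = 2 * of_real pi * \<i> * (\<Sum>p\<in>P. residue (\<lambda>x. S x * g x / x) p)"
    by (rule circlepath_residues[OF _ inverse_radius[OF r(1)] P(1,3) hol]) (use r0 in simp)
  finally show ?thesis .
qed

lemma circle_integrable_inverse:
  assumes r: "norm q < r" "r < 1" and P: "P \<subseteq> cball 0 1"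
    and hol: "(\<lambda>x. S x * g x / x) holomorphic_on ball 0 (1 / norm q) - P"
  shows "(\<lambda>x. S x * g (1 / x) / x) contour_integrable_on circlepath 0 r"
proof -
  have r0: "0 < r"
    using r norm_q_pos by linarith
  have 1: "1 < 1 / r"
    using r(2) by (subst less_divide_eq_1_pos[OF r0])
  have "(\<lambda>x. S (1 / x) * g (1 / x) / (1 / x)) holomorphic_on sphere 0 r"
  proof (rule holomorphic_on_compose_gen[of "\<lambda>x. 1 / x" _ _ "ball 0 (1 / norm q) - P", OF _ hol, unfolded o_def])
    show "(\<lambda>x. 1 / x) ` sphere 0 r \<subseteq> ball 0 (1 / norm q) - P"
      using P 1 inverse_radius[OF r(1)] by (fastforce simp: norm_divide)
  qed (use r0 in \<open>auto intro!: holomorphic_intros\<close>)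
  then have "(\<lambda>x. (S (1 / x) * g (1 / x) / (1 / x)) / x ^ 2) holomorphic_on sphere 0 r"
    using r0 by (auto intro!: holomorphic_intros)
  then have "(\<lambda>x. S x * g (1 / x) / x) holomorphic_on sphere 0 r"
    by (rule holomorphic_transform) (use r0 in \<open>auto simp: sym_factor_inverse power2_eq_square\<close>)
  then show ?thesis
    by (intro contour_integrable_continuous_circlepath holomorphic_on_imp_continuous_on) (use r0 in auto)
qed

text \<open>The weight 2 counts a pole once for the circle of radius r and once for the reflected
  one of radius 1/r; the point 1 lies inside the latter only.\<close>

lemma double_integral:
  "contour_integral (circlepath 0 1) (\<lambda>x. contour_integral (circlepath 0 1) (\<lambda>w. S x * (S w * S (w / x) / w) / x))
   = (2 * of_real pi * \<i>)^2 *
     ((\<Sum>p\<in>{0, q, q^3}. residue (\<lambda>x. S x / x) p)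
      + 2 * (\<Sum>p\<in>{0, q, q^2, q^3}. residue (\<lambda>x. S x * resA q x / x) p) + residue (\<lambda>x. S x * resA q x / x) 1
      + 2 * (\<Sum>p\<in>{0, q, q^3}. residue (\<lambda>x. S x * resB q x / x) p) + residue (\<lambda>x. S x * resB q x / x) 1)"
proof -
  obtain r where r: "norm q < r" "r < 1"
    using dense norm_q by blast
  have r0: "0 < r"
    using r norm_q_pos by linarith
  have r': "1 < 1 / r" "1 / r < 1 / norm q" "r < 1 / norm q"
  proof -
    show 1: "1 < 1 / r"
      using r(2) by (subst less_divide_eq_1_pos[OF r0])
    show 2: "1 / r < 1 / norm q"
      by (rule inverse_radius[OF r(1)])
    show "r < 1 / norm q"
      using 1 2 r(2) by linarith
  qed
  let ?c = "2 * of_real pi * \<i> :: complex"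
  let ?C = "circlepath 0 r"
  let ?A = "\<lambda>x. S x * resA q x / x" and ?B = "\<lambda>x. S x * resB q x / x"
  let ?A' = "\<lambda>x. S x * resA q (1 / x) / x" and ?B' = "\<lambda>x. S x * resB q (1 / x) / x"
  have arith: "c * (c * a + (c * b + (c * (b' + b) + (c * d + c * (d' + d))))) = c^2 * (a + 2 * b + b' + 2 * d + d')"
    for a b b' c d d' :: complex
    by algebra
  have small: "norm (q ^ n) < r" if "0 < n" for n
    using norm_q_power_le[OF that] r by auto
  have sub: "{0, q, q^2, q^3} \<subseteq> ball 0 r" "{0, q, q^3} \<subseteq> ball 0 r"
    using small[of 2] small[of 3] r r0 by auto
  have sub': "{0, q, q^2, q^3, 1} \<subseteq> ball 0 (1 / r)" "{0, q, q^3, 1} \<subseteq> ball 0 (1 / r)"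
  proof -
    have "ball 0 r \<subseteq> ball (0::complex) (1 / r)" "1 \<in> ball (0::complex) (1 / r)"
      using r(2) r'(1) by auto
    then show "{0, q, q^2, q^3, 1} \<subseteq> ball 0 (1 / r)" "{0, q, q^3, 1} \<subseteq> ball 0 (1 / r)"
      using sub by blast+
  qed
  have q1: "q \<noteq> 1" "q ^ 2 \<noteq> 1" "q ^ 3 \<noteq> 1"
    using q_power_ne_1[of 1] q_power_ne_1[of 2] q_power_ne_1[of 3] by auto
  have on_circle: "norm x = r \<Longrightarrow> x \<in> ball 0 (1 / norm q) - {0, q, q^2, q^3, 1}" for x
    using r r0 r' small[of 1] small[of 2] small[of 3] by auto
  have "contour_integral (circlepath 0 1) (\<lambda>x. contour_integral (circlepath 0 1) (\<lambda>w. S x * (S w * S (w / x) / w) / x))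
      = contour_integral ?C (\<lambda>x. contour_integral (circlepath 0 1) (\<lambda>w. S x * (S w * S (w / x) / w) / x))"
    by (rule kernel_radius[OF r])
  also have "\<dots> = contour_integral ?C (\<lambda>x. ?c * (S x / x + (?A x + (?A' x + (?B x + ?B' x)))))"
  proof (rule contour_integral_circlepath_cong)
    fix x :: complex assume x: "norm x = r"
    have "continuous_on (sphere 0 1) (\<lambda>w. S w * S (w / x) / w)"
    proof (intro continuous_intros)
      fix w :: complex assume w: "w \<in> sphere 0 1"
      then show "w \<notin> sing q"
        using norm_q by (intro not_sing_annulus less_inverse_norm) auto
      show "w / x \<notin> sing q"
        using w x r' norm_q by (intro not_sing_annulus) (auto simp: norm_divide)
    qed (use x r0 in auto)
    then have "(\<lambda>w. S w * S (w / x) / w) contour_integrable_on circlepath 0 1"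
      by (intro contour_integrable_continuous_circlepath) auto
    then have "contour_integral (circlepath 0 1) (\<lambda>w. (S x / x) * (S w * S (w / x) / w))
       = (S x / x) * contour_integral (circlepath 0 1) (\<lambda>w. S w * S (w / x) / w)"
      by (rule contour_integral_lmul)
    then show "contour_integral (circlepath 0 1) (\<lambda>w. S x * (S w * S (w / x) / w) / x)
       = ?c * (S x / x + (?A x + (?A' x + (?B x + ?B' x))))"
      using inner_integral[of x] x r by (simp add: field_simps add_divide_distrib)
  qed (use r0 in auto)
  also have "\<dots> = ?c * (contour_integral ?C (\<lambda>x. S x / x) + (contour_integral ?C ?A
     + (contour_integral ?C ?A' + (contour_integral ?C ?B + contour_integral ?C ?B'))))"
  proof -
    have 0: "(\<lambda>x. S x / x) contour_integrable_on ?C"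
      by (rule contour_integrable_continuous_circlepath,
          rule holomorphic_on_imp_continuous_on,
          rule holomorphic_on_subset[OF outer0_holomorphic]) (use on_circle r(2) r0 small[of 1] small[of 2] small[of 3] in auto)
    have A: "?A contour_integrable_on ?C"
      by (rule contour_integrable_continuous_circlepath,
          rule holomorphic_on_imp_continuous_on,
          rule holomorphic_on_subset[OF outerA_holomorphic]) (use on_circle r(2) r0 small[of 1] small[of 2] small[of 3] in auto)
    have B: "?B contour_integrable_on ?C"
      by (rule contour_integrable_continuous_circlepath,
          rule holomorphic_on_imp_continuous_on,
          rule holomorphic_on_subset[OF outerB_holomorphic]) (use on_circle r(2) r0 small[of 1] small[of 2] small[of 3] in auto)
    have A': "?A' contour_integrable_on ?C"
      by (rule circle_integrable_inverse[OF r _ outerA_holomorphic])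
         (use norm_q norm_q_power_le[of 2] norm_q_power_le[of 3] in auto)
    have B': "?B' contour_integrable_on ?C"
      by (rule circle_integrable_inverse[OF r _ outerB_holomorphic])
         (use norm_q norm_q_power_le[of 3] in auto)
    show ?thesis
      using contour_integral_lmul[OF contour_integrable_add[OF 0 contour_integrable_add[OF A
              contour_integrable_add[OF A' contour_integrable_add[OF B B']]]], of ?c]
        contour_integral_add[OF 0 contour_integrable_add[OF A contour_integrable_add[OF A'
              contour_integrable_add[OF B B']]]]
        contour_integral_add[OF A contour_integrable_add[OF A' contour_integrable_add[OF B B']]]
        contour_integral_add[OF A' contour_integrable_add[OF B B']]
        contour_integral_add[OF B B']
      by (simp only:)
  qed
  also have "contour_integral ?C (\<lambda>x. S x / x) = ?c * (\<Sum>p\<in>{0, q, q^3}. residue (\<lambda>x. S x / x) p)"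
    by (rule circlepath_residues[OF _ _ _ sub(2) outer0_holomorphic]) (use r' r0 in auto)
  also have "contour_integral ?C ?A = ?c * (\<Sum>p\<in>{0, q, q^2, q^3}. residue ?A p)"
  proof (rule circlepath_residues[OF _ _ _ sub(1)])
    show "?A holomorphic_on ball 0 1 - {0, q, q^2, q^3}"
      by (rule holomorphic_on_subset[OF outerA_holomorphic]) (use r r' in auto)
  qed (use r r0 in auto)
  also have "contour_integral ?C ?B = ?c * (\<Sum>p\<in>{0, q, q^3}. residue ?B p)"
  proof (rule circlepath_residues[OF _ _ _ sub(2)])
    show "?B holomorphic_on ball 0 1 - {0, q, q^3}"
      by (rule holomorphic_on_subset[OF outerB_holomorphic]) (use r r' in auto)
  qed (use r r0 in auto)
  also have "contour_integral ?C ?A' = ?c * (\<Sum>p\<in>{0, q, q^2, q^3, 1}. residue ?A p)"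
    by (rule circle_integral_inverse[OF r _ _ sub'(1) outerA_holomorphic]) auto
  also have "contour_integral ?C ?B' = ?c * (\<Sum>p\<in>{0, q, q^3, 1}. residue ?B p)"
    by (rule circle_integral_inverse[OF r _ _ sub'(2) outerB_holomorphic]) auto
  also have "(\<Sum>p\<in>{0, q, q^2, q^3, 1}. residue ?A p) = residue ?A 1 + (\<Sum>p\<in>{0, q, q^2, q^3}. residue ?A p)"
  proof -
    have "{0, q, q^2, q^3, 1} = insert 1 {0, q, q^2, q^3}"
      by auto
    then show ?thesis
      using q1 by (simp only:) (subst sum.insert, auto)
  qed
  also have "(\<Sum>p\<in>{0, q, q^3, 1}. residue ?B p) = residue ?B 1 + (\<Sum>p\<in>{0, q, q^3}. residue ?B p)"
  proof -
    have "{0, q, q^3, 1} = insert 1 {0, q, q^3}"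
      by auto
    then show ?thesis
      using q1 by (simp only:) (subst sum.insert, auto)
  qed
  finally show ?thesis
    by (simp only: arith)
qed

subsection \<open>The outer integrands in reduced form\<close>

lemma power_nonzero:
  "1 - q \<noteq> 0" "1 - q^2 \<noteq> 0" "1 - q^3 \<noteq> 0" "1 - q^4 \<noteq> 0" "1 - q^5 \<noteq> 0" "1 - q^6 \<noteq> 0"
  "1 - q^7 \<noteq> 0" "1 - q^9 \<noteq> 0" "q - 1 \<noteq> 0" "q^3 - 1 \<noteq> 0"
  "q - q^2 \<noteq> 0" "q - q^3 \<noteq> 0" "q^3 - q \<noteq> 0" "q^3 - q^2 \<noteq> 0" "q^2 - q^3 \<noteq> 0" "q^2 - q \<noteq> 0"
  "q^2 - 1 \<noteq> 0"
  using one_minus_q one_minus_q_power[of 2] one_minus_q_power[of 3] one_minus_q_power[of 4]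
    one_minus_q_power[of 5] one_minus_q_power[of 6] one_minus_q_power[of 7] one_minus_q_power[of 9]
    q_power_eq_iff[of 1 2] q_power_eq_iff[of 1 3] q_power_eq_iff[of 2 3]
  by auto

lemmas field_nonzero = q_nonzero power_nonzero cyclotomic_nonzero

text \<open>Contains the zeros of all linear factors, cancelled or not, in the outer integrands, so
  that the reduced forms hold off this set.\<close>

definition exceptional :: "complex set" where
  "exceptional = {0, 1, q, q^2, q^3, 1/q, 1/q^2, 1/q^3, 1/q^4, 1/q^5, 1/q^6}"

lemma finite_exceptional: "finite exceptional"
  by (simp add: exceptional_def)

lemma exceptional_nonzero:
  assumes "x \<notin> exceptional"
  shows "x \<noteq> 0" "x - 1 \<noteq> 0" "x - q \<noteq> 0" "x - q^2 \<noteq> 0" "x - q^3 \<noteq> 0" "1 - q * x \<noteq> 0"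
    "1 - q^2 * x \<noteq> 0" "1 - q^3 * x \<noteq> 0" "1 - q^4 * x \<noteq> 0" "1 - q^5 * x \<noteq> 0" "1 - q^6 * x \<noteq> 0"
proof -
  have "1 - q ^ n * x \<noteq> 0" if "x \<noteq> 1 / q ^ n" for n
    using that q_nonzero by (auto simp: field_simps)
  from this[of 1] this[of 2] this[of 3] this[of 4] this[of 5] this[of 6]
  show "x \<noteq> 0" "x - 1 \<noteq> 0" "x - q \<noteq> 0" "x - q^2 \<noteq> 0" "x - q^3 \<noteq> 0" "1 - q * x \<noteq> 0"
    "1 - q^2 * x \<noteq> 0" "1 - q^3 * x \<noteq> 0" "1 - q^4 * x \<noteq> 0" "1 - q^5 * x \<noteq> 0" "1 - q^6 * x \<noteq> 0"
    using assms by (auto simp: exceptional_def)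
qed

text \<open>The triple pole at q cancels and the poles left in the closed unit disc, at 0, 1 and
  q^3, are simple, with a double zero at q^2. Multiplied by the bracket of \<open>ell1\<close> and
  \<open>ell2\<close>, this gives order two at q, order three at 1 and no pole at q^2.\<close>

lemma sym_factor_product_A:
  assumes "x \<notin> exceptional"
  shows "S x * S (q * x) / x = (1 - q^3 * x)^2 * (x - q^2)^2 /
     ((1 - q^4 * x) * (x - 1) * (x - q^3) * (1 - q * x) * x) / q"
proof -
  \<comment> \<open>One letter per distinct linear factor, so the cancellation is checked without
    expanding in x and q.\<close>
  have arith: "- ((- T)^2 * B^3 * C^3 / (D * E * F^3 * G^3)) *
      - (F^2 * D^3 * (q * G)^3 / (H * (q * C) * B^3 * (q * T)^3)) / x
    = D^2 * C^2 / (H * T * E * F * x) / q"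
    if "T \<noteq> 0" "B \<noteq> 0" "C \<noteq> 0" "D \<noteq> 0" "E \<noteq> 0" "F \<noteq> 0" "G \<noteq> 0" "H \<noteq> 0" "x \<noteq> 0"
    for T B C D E F G H x
    by (simp only: clear_denominators that q_nonzero, algebra)
  have e: "1 - x = - (x - 1)" "1 - q^2 * (q * x) = 1 - q^3 * x" "q * x - q^2 = q * (x - q)"
    "1 - q^3 * (q * x) = 1 - q^4 * x" "q * x - q^3 = q * (x - q^2)" "1 - q * (q * x) = 1 - q^2 * x"
    "q * x - q = q * (x - 1)"
    by (simp_all add: algebra_simps eval_nat_numeral)
  show ?thesis
    unfolding sym_factor_def e by (rule arith) (use exceptional_nonzero[OF assms] in auto)
qed

text \<open>Here (1 - x)^2 outweighs the simple pole of S(q^3 x) at 1, leaving a zero; q stays a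
  triple pole, 0 and q^3 are simple poles.\<close>

lemma sym_factor_product_B:
  assumes "x \<notin> exceptional"
  shows "S x * S (q^3 * x) / x = (1 - q^3 * x) * (1 - q^5 * x)^3 * (x - 1) * (x - q^2)^3 /
     ((1 - q^6 * x) * (1 - q^4 * x)^3 * (x - q^3) * (x - q)^3 * x)"
proof -
  have arith: "- ((- T)^2 * B^3 * C^3 / (D * E * F^3 * G^3)) *
      - (D^2 * I^3 * (- (q^2 * F))^3 / (J * (q^3 * T) * H^3 * (- (q * B))^3)) / x
    = D * I^3 * T * C^3 / (J * H^3 * E * G^3 * x)"
    if "T \<noteq> 0" "B \<noteq> 0" "C \<noteq> 0" "D \<noteq> 0" "E \<noteq> 0" "F \<noteq> 0" "G \<noteq> 0" "H \<noteq> 0" "I \<noteq> 0" "J \<noteq> 0" "x \<noteq> 0"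
    for T B C D E F G H I J x
    by (simp only: clear_denominators that q_nonzero, algebra)
  have e: "1 - x = - (x - 1)"
    "1 - q^2 * (q^3 * x) = 1 - q^5 * x" "q^3 * x - q^2 = - (q^2 * (1 - q * x))"
    "1 - q^3 * (q^3 * x) = 1 - q^6 * x" "q^3 * x - q^3 = q^3 * (x - 1)" "1 - q * (q^3 * x) = 1 - q^4 * x"
    "q^3 * x - q = - (q * (1 - q^2 * x))"
    by (simp_all add: algebra_simps eval_nat_numeral)
  show ?thesis
    unfolding sym_factor_def e by (rule arith) (use exceptional_nonzero[OF assms] in auto)
qed

text \<open>The constant of \<open>resA\<close> divided by q; the division absorbs the 1/q in the
  reduced product S(x) S(q x) / x.\<close>

definition cA :: complex where
  "cA = - ((1 - q)^5 * (1 - q^3)^3 / (q^2 * (1 - q^4) * (1 - q^2)^4))"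

text \<open>The constant of \<open>resB\<close>, and also the residue of S(u)/u at q^3.\<close>

definition cB :: complex where
  "cB = - ((1 - q)^3 * (1 - q^3)^2 * (1 - q^5)^3 / ((1 - q^2)^3 * (1 - q^4)^3 * (1 - q^6)))"

lemma outerA_eq:
  assumes "x \<notin> exceptional"
  shows "S x * resA q x / x = cA * ((1 - q^3 * x)^2 * (x - q^2)^2 /
     ((1 - q^4 * x) * (x - 1) * (x - q^3) * (1 - q * x) * x)) * ((ell1 q x)^2 - ell2 q x) / 2"
proof -
  have "S x * resA q x / x = (S x * S (q * x) / x) * (q * cA) * ((ell1 q x)^2 - ell2 q x) / 2"
    using q_nonzero by (simp add: resA_def cA_def power2_eq_square mult_ac)
  then show ?thesis
    unfolding sym_factor_product_A[OF assms] using q_nonzero by (simp add: mult_ac)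
qed

lemma outerB_eq:
  assumes "x \<notin> exceptional"
  shows "S x * resB q x / x = cB * ((1 - q^3 * x) * (1 - q^5 * x)^3 * (x - 1) * (x - q^2)^3 /
     ((1 - q^6 * x) * (1 - q^4 * x)^3 * (x - q^3) * (x - q)^3 * x))"
  unfolding sym_factor_product_B[OF assms, symmetric] by (simp add: resB_def cB_def)

text \<open>The part of \<open>ell1\<close> regular on the closed unit disc; the terms split off are
  singular at q, q^2 and 1.\<close>

definition ell1b :: "complex \<Rightarrow> complex" where
  "ell1b x = ell0 q - 2 * (q * x / (1 - q * x)) - 3 * (q^3 * x / (1 - q^3 * x))
     + q^4 * x / (1 - q^4 * x) + 3 * (q^2 * x / (1 - q^2 * x))"

definition ell2b :: "complex \<Rightarrow> complex" where
  "ell2b x = ell0' q + 2 * (q * x / (1 - q * x))^2 + 3 * (q^3 * x / (1 - q^3 * x))^2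
     - (q^4 * x / (1 - q^4 * x))^2 - 3 * (q^2 * x / (1 - q^2 * x))^2"

lemma ell1_eq: "ell1 q x = ell1b x + 3 * (x / (x - q)) - x / (x - q^2) - 3 * (x / (x - 1))"
  and ell2_eq: "ell2 q x = ell2b x + 3 * (x / (x - q))^2 - (x / (x - q^2))^2 - 3 * (x / (x - 1))^2"
  by (simp_all add: ell1_def ell2_def ell1b_def ell2b_def)

lemma ellb_analytic [analytic_intros]:
  assumes "norm p \<le> 1"
  shows "ell1b analytic_on {p}" "ell2b analytic_on {p}"
  using one_minus_power_mult[OF _ less_inverse_norm[OF assms], of 1]
    one_minus_power_mult[OF _ less_inverse_norm[OF assms], of 2]
    one_minus_power_mult[OF _ less_inverse_norm[OF assms], of 3]
    one_minus_power_mult[OF _ less_inverse_norm[OF assms], of 4]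
  unfolding ell1b_def [abs_def] ell2b_def [abs_def] by (auto intro!: analytic_intros)

lemma one_minus_power_mult_le:
  assumes "norm p \<le> 1"
  shows "1 - q * p \<noteq> 0" "1 - q^2 * p \<noteq> 0" "1 - q^3 * p \<noteq> 0" "1 - q^4 * p \<noteq> 0" "1 - q^5 * p \<noteq> 0"
    "1 - q^6 * p \<noteq> 0"
  using one_minus_power_mult[OF _ less_inverse_norm[OF assms], of 1]
    one_minus_power_mult[OF _ less_inverse_norm[OF assms], of 2]
    one_minus_power_mult[OF _ less_inverse_norm[OF assms], of 3]
    one_minus_power_mult[OF _ less_inverse_norm[OF assms], of 4]
    one_minus_power_mult[OF _ less_inverse_norm[OF assms], of 5]
    one_minus_power_mult[OF _ less_inverse_norm[OF assms], of 6] by auto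

lemma norm_q_power_le_1: "norm (q ^ n) \<le> 1" "norm q \<le> 1"
  using norm_q by (auto simp: norm_power power_le_one)

subsection \<open>Residues of the constant term\<close>

lemma residue_outer0_0: "residue (\<lambda>x. S x / x) 0 = 1"
proof -
  have "residue (\<lambda>x. S x / x) 0 = S 0"
    by (rule residue_pole1[of _ _ "{}"]) (use q_nonzero in \<open>auto intro!: analytic_intros simp: sing_def\<close>)
  then show ?thesis
    using q_nonzero by (simp add: sym_factor_def eval_nat_numeral)
qed

lemma residue_outer0_q: "residue (\<lambda>x. S x / x) q = q * cA * ((ell0 q)^2 - ell0' q) / 2"
proof -
  let ?g = "\<lambda>w. (1 - w) ^ 2 * (1 - q ^ 2 * w) ^ 3 * (w - q ^ 2 * 1) ^ 3 /
       ((1 - q ^ 3 * w) * (w - q ^ 3 * 1) * (1 - q * w) ^ 3) / w"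
  have "logjet (\<lambda>w. (-1) * ?g w) q ((-1) * (q^2 * ((1 - q)^5 * (1 - q^3)^3 / (q * (1 - q^4) * (1 - q^2)^4))))
     (0 + ell0 q) (0 + ell0' q)"
    using logjet_mult[OF logjet_const logjet_sym_factor_q[of 1], of "-1"] q_nonzero by simp
  from residue_logjet[OF this, of "{}" "\<lambda>x. S x / x"] show ?thesis
    using q_nonzero by (simp add: sym_factor_def cA_def power2_eq_square mult_ac)
qed

lemma residue_outer0_q3: "residue (\<lambda>x. S x / x) (q^3) = cB"
proof -
  define g where "g = (\<lambda>u. - ((1 - u) ^ 2 * (1 - q ^ 2 * u) ^ 3 * (u - q ^ 2) ^ 3 /
     ((1 - q ^ 3 * u) * (1 - q * u) ^ 3 * (u - q) ^ 3)) / u)"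
  have e: "1 - q^3 * q^3 = 1 - q^6" "1 - q * q^3 = 1 - q^4"
    by (simp_all add: eval_nat_numeral)
  have "g analytic_on {q^3}"
    unfolding g_def by (intro analytic_intros) (use field_nonzero e in auto)
  then have "residue (\<lambda>x. S x / x) (q^3) = g (q^3)"
    by (rule residue_pole1[of _ _ "{}"]) (simp_all add: sym_factor_def g_def mult_ac)
  also have "g (q^3) = cB"
    unfolding g_def cB_def e by (simp only: clear_denominators field_nonzero, algebra)
  finally show ?thesis .
qed

subsection \<open>Residues of the second outer integrand\<close>

lemma residue_outerB_0: "residue (\<lambda>x. S x * resB q x / x) 0 = cB"
proof -
  define g where "g = (\<lambda>x. cB * ((1 - q^3 * x) * (1 - q^5 * x)^3 * (x - 1) * (x - q^2)^3 /
     ((1 - q^6 * x) * (1 - q^4 * x)^3 * (x - q^3) * (x - q)^3)))"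
  have "g analytic_on {0}"
    unfolding g_def by (intro analytic_intros) (use q_nonzero in auto)
  then have "residue (\<lambda>x. S x * resB q x / x) 0 = g 0"
    by (rule residue_pole1[OF _ finite_exceptional]) (simp add: outerB_eq g_def)
  also have "g 0 = cB"
    unfolding g_def using q_nonzero by (simp add: eval_nat_numeral)
  finally show ?thesis .
qed

lemma residue_outerB_1: "residue (\<lambda>x. S x * resB q x / x) 1 = 0"
proof (rule residue_eq_0_finite[OF _ finite_exceptional])
  show "(\<lambda>x. cB * ((1 - q^3 * x) * (1 - q^5 * x)^3 * (x - 1) * (x - q^2)^3 /
     ((1 - q^6 * x) * (1 - q^4 * x)^3 * (x - q^3) * (x - q)^3 * x))) analytic_on {1}"
    by (intro analytic_intros) (use field_nonzero in auto)
qed (rule outerB_eq)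

lemma residue_outerB_q3: "residue (\<lambda>x. S x * resB q x / x) (q^3) =
  (1 - q)^2 * (1 + q + q^2)^2 * (1 + q + q^2 + q^3 + q^4)^3 * (1 + q^4)^3 / ((1 + q)^6 * (1 + q + q^2 + q^3 + q^4 + q^5 + q^6)^3 * (1 + q^3 + q^6))"
proof -
  define g where "g = (\<lambda>x. cB * ((1 - q^3 * x) * (1 - q^5 * x)^3 * (x - 1) * (x - q^2)^3 /
     ((1 - q^6 * x) * (1 - q^4 * x)^3 * (x - q)^3 * x)))"
  have e: "1 - q^6 * q^3 = 1 - q^9" "1 - q^4 * q^3 = 1 - q^7" "1 - q^3 * q^3 = 1 - q^6" "1 - q^5 * q^3 = 1 - q^8"
    by (simp_all add: eval_nat_numeral)
  have "g analytic_on {q^3}"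
    unfolding g_def by (intro analytic_intros) (use field_nonzero e in auto)
  then have "residue (\<lambda>x. S x * resB q x / x) (q^3) = g (q^3)"
    by (rule residue_pole1[OF _ finite_exceptional]) (subst outerB_eq, assumption, simp add: g_def mult_ac)
  also have "g (q^3) = (1 - q)^2 * (1 + q + q^2)^2 * (1 + q + q^2 + q^3 + q^4)^3 * (1 + q^4)^3 / ((1 + q)^6 * (1 + q + q^2 + q^3 + q^4 + q^5 + q^6)^3 * (1 + q^3 + q^6))"
    unfolding g_def cB_def e by (simp only: clear_denominators field_nonzero, algebra)
  finally show ?thesis .
qed

text \<open>
  The same pair \<open>gam1\<close>, \<open>gam2\<close> occurs at the triple pole \<open>q\<close> of the second outer integrand and at the
  simple pole \<open>q\<^sup>3\<close> of the first one.
\<close>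

definition gam1 :: complex where
  "gam1 = (1 + 4*q + 9*q^2 + 18*q^3 + 28*q^4 + 44*q^5 + 55*q^6 + 69*q^7 + 73*q^8 + 75*q^9 + 69*q^10 + 62*q^11 + 46*q^12 + 35*q^13 + 20*q^14 + 12*q^15 + 5*q^16 + 2*q^17) / ((1 - q) * (1 + q) * (1 + q + q^2) * (1 + q^2) * (1 + q + q^2 + q^3 + q^4) * (1 - q + q^2) * (1 + q + q^2 + q^3 + q^4 + q^5 + q^6))"

definition gam2 :: complex where
  "gam2 = (1 + 10*q + 44*q^2 + 146*q^3 + 391*q^4 + 908*q^5 + 1872*q^6 + 3512*q^7 + 6062*q^8 + 9740*q^9 + 14652*q^10 + 20770*q^11 + 27841*q^12 + 35422*q^13 + 42865*q^14 + 49444*q^15 + 54421*q^16 + 57218*q^17 + 57481*q^18 + 55186*q^19 + 50609*q^20 + 44304*q^21 + 36974*q^22 + 29366*q^23 + 22148*q^24 + 15810*q^25 + 10643*q^26 + 6720*q^27 + 3954*q^28 + 2148*q^29 + 1066*q^30 + 472*q^31 + 183*q^32 + 58*q^33 + 14*q^34 + 2*q^35) / ((1 - q)^2 * (1 + q)^2 * (1 + q + q^2)^2 * (1 + q^2)^2 * (1 + q + q^2 + q^3 + q^4)^2 * (1 - q + q^2)^2 * (1 + q + q^2 + q^3 + q^4 + q^5 + q^6)^2)"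

lemma residue_outerB_q: "residue (\<lambda>x. S x * resB q x / x) q = cB *
  (- (q * (1 - q)^3 * (1 + q)^3 * (1 + q + q^2)^3 * (1 + q^2) * (1 - q + q^2)^3 / ((1 + q + q^2 + q^3 + q^4)^3 * (1 + q + q^2 + q^3 + q^4 + q^5 + q^6)))) * (gam1^2 - gam2) / (2 * q^2)"
proof -
  let ?g = "\<lambda>x. (1 - q^3 * x) * (1 - q^5 * x)^3 * (x - 1) * (x - q^2)^3 /
     ((1 - q^6 * x) * (1 - q^4 * x)^3 * (x - q^3) * x)"
  have e: "q^6 * q = q^7" "q^4 * q = q^5" "q^3 * q = q^4" "q^5 * q = q^6"
    by (simp_all add: eval_nat_numeral)
  have nz: "1 - q^3 * q \<noteq> 0" "1 - q^5 * q \<noteq> 0" "q - 1 \<noteq> 0" "q - q^2 \<noteq> 0" "1 - q^6 * q \<noteq> 0"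
    "1 - q^4 * q \<noteq> 0" "q - q^3 \<noteq> 0"
    unfolding e using field_nonzero by auto
  have "logjet ?g q (- (q * (1 - q)^3 * (1 + q)^3 * (1 + q + q^2)^3 * (1 + q^2) * (1 - q + q^2)^3 / ((1 + q + q^2 + q^3 + q^4)^3 * (1 + q + q^2 + q^3 + q^4 + q^5 + q^6)))) gam1 gam2"
    apply (rule logjet_eq, (rule logjet_intros q_nonzero nz no_zero_divisors power_not_zero)+)
      apply (simp_all only: e)
    subgoal
      by (simp only: clear_denominators field_nonzero, algebra)
    subgoal
      unfolding gam1_def of_nat_numeral
      by (simp only: clear_denominators field_nonzero, algebra)
    subgoal
      unfolding gam2_def of_nat_numeral
      by (simp only: clear_denominators field_nonzero, algebra)
    done
  then have "logjet (\<lambda>x. cB * ?g x) q (cB * (- (q * (1 - q)^3 * (1 + q)^3 * (1 + q + q^2)^3 * (1 + q^2) * (1 - q + q^2)^3 / ((1 + q + q^2 + q^3 + q^4)^3 * (1 + q + q^2 + q^3 + q^4 + q^5 + q^6))))) (0 + gam1) (0 + gam2)"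
    by (intro logjet_mult logjet_const q_nonzero)
  then have lj: "logjet (\<lambda>x. cB * ?g x) q (cB * (- (q * (1 - q)^3 * (1 + q)^3 * (1 + q + q^2)^3 * (1 + q^2) * (1 - q + q^2)^3 / ((1 + q + q^2 + q^3 + q^4)^3 * (1 + q + q^2 + q^3 + q^4 + q^5 + q^6))))) gam1 gam2"
    by simp
  show ?thesis
    by (rule residue_logjet[OF lj finite_exceptional]) (subst outerB_eq, assumption, simp add: mult_ac)
qed

subsection \<open>Residues of the first outer integrand\<close>

text \<open>At x = 0 the factor S(q x) becomes S(0) = 1 and \<open>ell1\<close>, \<open>ell2\<close>
  reduce to \<open>ell0\<close>, \<open>ell0'\<close>, so the residue of S(x)/x at q
  reappears.\<close>

lemma residue_outerA_0: "residue (\<lambda>x. S x * resA q x / x) 0 = q * cA * ((ell0 q)^2 - ell0' q) / 2"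
proof -
  define g where "g = (\<lambda>x. cA * ((1 - q^3 * x)^2 * (x - q^2)^2 /
     ((1 - q^4 * x) * (x - 1) * (x - q^3) * (1 - q * x))) * ((ell1 q x)^2 - ell2 q x) / 2)"
  have "g analytic_on {0}"
    unfolding g_def ell1_eq ell2_eq by (intro analytic_intros) (use q_nonzero in auto)
  then have "residue (\<lambda>x. S x * resA q x / x) 0 = g 0"
    by (rule residue_pole1[OF _ finite_exceptional]) (subst outerA_eq, assumption, simp add: g_def mult_ac)
  also have "g 0 = q * cA * ((ell0 q)^2 - ell0' q) / 2"
    unfolding g_def ell1_def ell2_def using q_nonzero by (simp add: eval_nat_numeral)
  finally show ?thesis .
qed

text \<open>The double zero of the reduced product cancels the double pole of the bracket;
  distributing (x - q^2)^2 over the bracket exhibits a regular function.\<close>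

lemma residue_outerA_q2: "residue (\<lambda>x. S x * resA q x / x) (q^2) = 0"
proof (rule residue_eq_0_finite[OF _ finite_exceptional])
  let ?L = "\<lambda>x. ell1b x + 3 * (x / (x - q)) - 3 * (x / (x - 1))"
  let ?M = "\<lambda>x. ell2b x + 3 * (x / (x - q))^2 - 3 * (x / (x - 1))^2"
  let ?g = "\<lambda>x. cA * ((1 - q^3 * x)^2 / ((1 - q^4 * x) * (x - 1) * (x - q^3) * (1 - q * x) * x)) *
     (((x - q^2) * ?L x - x)^2 - ((x - q^2)^2 * ?M x - x^2)) / 2"
  show "?g analytic_on {q^2}"
    by (intro analytic_intros)
       (use field_nonzero norm_q_power_le_1(1)[of 2] one_minus_power_mult_le[of "q^2"] in auto)
  fix x assume x: "x \<notin> exceptional"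
  have *: "D / (E * x) * C^2 * ((L + U - x / C - V)^2 - (M + P - (x / C)^2 - Q))
     = D / (E * x) * ((C * (L + U - V) - x)^2 - (C^2 * (M + P - Q) - x^2))"
    if "C \<noteq> 0" "E \<noteq> 0" "x \<noteq> 0" for C D E L M U V P Q x :: complex
    by (simp only: clear_denominators that, algebra)
  let ?E = "(1 - q^4 * x) * (x - 1) * (x - q^3) * (1 - q * x)"
  have "S x * resA q x / x = cA * ((1 - q^3 * x)^2 / (?E * x) * (x - q^2)^2 * ((ell1 q x)^2 - ell2 q x)) / 2"
    unfolding outerA_eq[OF x] by simp
  also have "\<dots> = ?g x"
    unfolding ell1_eq ell2_eq by (subst *) (use exceptional_nonzero[OF x] in \<open>simp_all add: mult_ac\<close>)
  finally show "S x * resA q x / x = ?g x" .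
qed

lemma ell_q3: "ell1 q (q^3) = gam1" "ell2 q (q^3) = gam2"
proof -
  have e: "q * q^3 = q^4" "q^2 * q^3 = q^5" "q^3 * q^3 = q^6" "q^4 * q^3 = q^7"
    by (simp_all add: eval_nat_numeral)
  show "ell1 q (q^3) = gam1"
    unfolding ell1_def gam1_def ell0_def e by (simp only: clear_denominators field_nonzero, algebra)
  show "ell2 q (q^3) = gam2"
    unfolding ell2_def gam2_def ell0'_def e by (simp only: clear_denominators field_nonzero, algebra)
qed

lemma residue_outerA_q3: "residue (\<lambda>x. S x * resA q x / x) (q^3) = cA * (- (q * (1 - q) * (1 + q) * (1 + q + q^2) * (1 - q + q^2)^2 / ((1 + q^2) * (1 + q + q^2 + q^3 + q^4 + q^5 + q^6)))) * (gam1^2 - gam2) / 2"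
proof -
  define g where "g = (\<lambda>x. cA * ((1 - q^3 * x)^2 * (x - q^2)^2 /
     ((1 - q^4 * x) * (x - 1) * (1 - q * x) * x)) * ((ell1 q x)^2 - ell2 q x) / 2)"
  have "g analytic_on {q^3}"
    unfolding g_def ell1_eq ell2_eq
    by (intro analytic_intros)
       (use field_nonzero norm_q_power_le_1(1)[of 3] one_minus_power_mult_le[of "q^3"] in auto)
  then have "residue (\<lambda>x. S x * resA q x / x) (q^3) = g (q^3)"
    by (rule residue_pole1[OF _ finite_exceptional]) (subst outerA_eq, assumption, simp add: g_def mult_ac)
  also have "g (q^3) = cA * (- (q * (1 - q) * (1 + q) * (1 + q + q^2) * (1 - q + q^2)^2 / ((1 + q^2) * (1 + q + q^2 + q^3 + q^4 + q^5 + q^6)))) * (gam1^2 - gam2) / 2"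
  proof -
    have e: "q * q^3 = q^4" "q^2 * q^3 = q^5" "q^3 * q^3 = q^6" "q^4 * q^3 = q^7"
      by (simp_all add: eval_nat_numeral)
    have "(1 - q^6)^2 * (q^3 - q^2)^2 / ((1 - q^7) * (q^3 - 1) * (1 - q^4) * q^3) = - (q * (1 - q) * (1 + q) * (1 + q + q^2) * (1 - q + q^2)^2 / ((1 + q^2) * (1 + q + q^2 + q^3 + q^4 + q^5 + q^6)))"
      by (simp only: clear_denominators field_nonzero, algebra)
    then show ?thesis
      unfolding g_def ell_q3 e by simp
  qed
  finally show ?thesis .
qed

text \<open>L carries a factor x - p and the combination L^2 - M a factor (x - p)^2. Hence the
  second-order jet involves only the value and first derivative of L and the value of M. It is
  applied with k = 3 at q and k = -3 at 1.\<close>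

lemma jet_quadratic:
  assumes L: "jet L p l0 l1 l2" and M: "jet M p m0 m1 m2"
  shows "jet (\<lambda>x. ((x - p)^2 * ((L x)^2 - M x) + 2 * k * x * (x - p) * L x + (k^2 - k) * x^2) / 2) p
    ((k^2 - k) * p^2 / 2) (k * p * l0 + (k^2 - k) * p)
    ((l0^2 - m0) / 2 + k * (l0 + p * l1) + (k^2 - k) / 2)"
proof -
  have t: "jet (\<lambda>x. - p + 1 * x) p 0 1 0"
    by (rule jet_eq[OF jet_linear]) auto
  have i: "jet (\<lambda>x. 0 + 1 * x) p p 1 0"
    by (rule jet_eq[OF jet_linear]) auto
  note c = jet_const
  note j = jet_add[OF
      jet_mult[OF c[of "1/2"] jet_mult[OF jet_mult[OF t t] jet_add[OF jet_mult[OF L L] jet_mult[OF c[of "-1"] M]]]]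
      jet_add[OF jet_mult[OF c[of k] jet_mult[OF i jet_mult[OF t L]]]
        jet_mult[OF c[of "(k^2 - k) / 2"] jet_mult[OF i i]]]]
  have "(\<lambda>x. 1 / 2 * ((- p + 1 * x) * (- p + 1 * x) * (L x * L x + - 1 * M x)) +
          (k * ((0 + 1 * x) * ((- p + 1 * x) * L x)) + (k^2 - k) / 2 * ((0 + 1 * x) * (0 + 1 * x))))
    = (\<lambda>x. ((x - p)^2 * ((L x)^2 - M x) + 2 * k * x * (x - p) * L x + (k^2 - k) * x^2) / 2)"
    by (rule ext) (simp add: field_simps power2_eq_square)
  with j show ?thesis
    by (auto elim!: jet_eq simp: field_simps power2_eq_square)
qed

text \<open>
  At \<open>p = q\<close> and \<open>p = 1\<close> one term of \<open>ell1\<close> and \<open>ell2\<close> is itself singular and raises the order of the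
  pole by two; the numerator on the right-hand side is the function treated in \<open>jet_quadratic\<close>.
\<close>

lemma pole_split:
  fixes x :: complex
  assumes "x \<noteq> p"
  shows "(L + k * (x / (x - p)))^2 - (M + k * (x / (x - p))^2)
    = 2 * (((x - p)^2 * (L^2 - M) + 2 * k * x * (x - p) * L + (k^2 - k) * x^2) / 2) / (x - p)^2"
  by (simp only: clear_denominators right_minus_eq assms, algebra)

lemma residue_outerA_q: "residue (\<lambda>x. S x * resA q x / x) q = (6 + 12*q + 12*q^3 + 6*q^4) * (1 - q)^2 * (1 + q + q^2)^5 / (q * (1 + q)^6 * (1 + q + q^2 + q^3 + q^4)^2)"
proof -
  define \<Phi> where "\<Phi> = (\<lambda>x. (1 - q^3 * x)^2 * (x - q^2)^2 /
     ((1 - q^4 * x) * (x - 1) * (x - q^3) * (1 - q * x) * x))"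
  define L where "L = (\<lambda>x. ell1b x - x / (x - q^2) - 3 * (x / (x - 1)))"
  define M where "M = (\<lambda>x. ell2b x - (x / (x - q^2))^2 - 3 * (x / (x - 1))^2)"
  define N where "N = (\<lambda>x. ((x - q)^2 * ((L x)^2 - M x) + 2 * 3 * x * (x - q) * L x + (3^2 - 3) * x^2) / 2)"
  \<comment> \<open>The value \<open>l\<close> of \<open>L\<close> at q and the Euler derivative
    \<open>a\<close> of \<open>\<Phi>\<close> at q turn out to be the same rational
    function.\<close>
  define l where "l = (3 + 6*q + 9*q^2 + 10*q^3 + 11*q^4 + 8*q^5 + 5*q^6 + 2*q^7) * q / ((1 - q) * (1 + q) * (1 + q^2) * (1 + q + q^2 + q^3 + q^4))"
  define a where "a = (3 + 6*q + 9*q^2 + 10*q^3 + 11*q^4 + 8*q^5 + 5*q^6 + 2*q^7) * q / ((1 - q) * (1 + q) * (1 + q^2) * (1 + q + q^2 + q^3 + q^4))"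
  have e: "q * q = q^2" "q^2 * q = q^3" "q^3 * q = q^4" "q^4 * q = q^5"
    by (simp_all add: eval_nat_numeral)
  have lq: "L q = l"
    unfolding L_def l_def ell1b_def ell0_def e by (simp only: clear_denominators field_nonzero, algebra)
  have an: "L analytic_on {q}" "M analytic_on {q}"
    unfolding L_def M_def by (intro analytic_intros; use field_nonzero norm_q in force)+
  have "\<exists>l1 l2. jet L q (L q) l1 l2" "\<exists>m1 m2. jet M q (M q) m1 m2"
    using jet_of_derivative[OF an(1)] jet_of_derivative[OF an(2)] an
    by (metis analytic_on_imp_differentiable_at insertI1 field_differentiable_derivI)+
  then obtain l1 l2 m1 m2 where jL: "jet L q l l1 l2" and jM: "jet M q (M q) m1 m2"
    unfolding lq by blast
  have jN: "jet N q (3 * q^2) (3 * q * l + 6 * q) ((l^2 - M q) / 2 + 3 * (l + q * l1) + 3)"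
    unfolding N_def by (rule jet_eq[OF jet_quadratic[OF jL jM]]) auto
  have nz: "1 - q^3 * q \<noteq> 0" "q - q^2 \<noteq> 0" "1 - q^4 * q \<noteq> 0" "q - 1 \<noteq> 0" "q - q^3 \<noteq> 0" "1 - q * q \<noteq> 0"
    unfolding e using field_nonzero by auto
  \<comment> \<open>The pole is double, so only first-order data enter and b remains
    existential.\<close>
  have "\<exists>b. logjet \<Phi> q (- ((1 + q^2)^2 / ((1 + q + q^2 + q^3 + q^4)))) a b"
    unfolding \<Phi>_def
    apply (rule exI, rule logjet_eq, (rule logjet_intros q_nonzero nz no_zero_divisors power_not_zero)+)
      apply (simp_all only: e)
    subgoal
      by (simp only: clear_denominators field_nonzero, algebra)
    subgoal
      unfolding a_def of_nat_numeral
      by (simp only: clear_denominators field_nonzero, algebra)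
    done
  then obtain c2 where "jet \<Phi> q (- ((1 + q^2)^2 / ((1 + q + q^2 + q^3 + q^4)))) ((- ((1 + q^2)^2 / ((1 + q + q^2 + q^3 + q^4)))) * a / q) c2"
    unfolding logjet_def by blast
  note j = jet_mult[OF jet_const[of cA] jet_mult[OF this jN]]
  have "residue (\<lambda>x. S x * resA q x / x) q = cA * ((- ((1 + q^2)^2 / ((1 + q + q^2 + q^3 + q^4)))) * (3 * q * l + 6 * q) + (- ((1 + q^2)^2 / ((1 + q + q^2 + q^3 + q^4)))) * a / q * (3 * q^2))"
  proof (rule trans[OF residue_pole2[OF j finite_exceptional]])
    fix x assume x: "x \<notin> exceptional"
    have "(ell1 q x)^2 - ell2 q x = 2 * N x / (x - q)^2"
    proof -
      have "ell1 q x = L x + 3 * (x / (x - q))" "ell2 q x = M x + 3 * (x / (x - q))^2"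
        by (simp_all add: ell1_eq ell2_eq L_def M_def)
      then show ?thesis
        unfolding N_def by (simp only:) (rule pole_split, use exceptional_nonzero[OF x] in auto)
    qed
    then show "S x * resA q x / x = cA * (\<Phi> x * N x) / (x - q)^2"
      unfolding outerA_eq[OF x] \<Phi>_def by (simp add: mult_ac)
  qed simp
  also have "\<dots> = (6 + 12*q + 12*q^3 + 6*q^4) * (1 - q)^2 * (1 + q + q^2)^5 / (q * (1 + q)^6 * (1 + q + q^2 + q^3 + q^4)^2)"
    unfolding a_def l_def cA_def by (simp only: clear_denominators field_nonzero, algebra)
  finally show ?thesis .
qed

text \<open>The simple pole of the reduced product and the double pole of the bracket add up to
  order three, so the derivative \<open>l1\<close> of \<open>L\<close> and the full second-order
  data of \<open>\<Phi>\<close> enter.\<close>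

lemma residue_outerA_1: "residue (\<lambda>x. S x * resA q x / x) 1 = - ((12 + 32*q + 78*q^2 + 108*q^3 + 140*q^4 + 108*q^5 + 78*q^6 + 32*q^7 + 12*q^8) * (1 - q)^2 * (1 + q + q^2)^2 / (q * (1 + q)^6 * (1 + q^2)^3))"
proof -
  define \<Phi> where "\<Phi> = (\<lambda>x. (1 - q^3 * x)^2 * (x - q^2)^2 /
     ((1 - q^4 * x) * (x - q^3) * (1 - q * x) * x))"
  define L where "L = (\<lambda>x. ell1b x + 3 * (x / (x - q)) - x / (x - q^2))"
  define M where "M = (\<lambda>x. ell2b x + 3 * (x / (x - q))^2 - (x / (x - q^2))^2)"
  define N where "N = (\<lambda>x. ((x - 1)^2 * ((L x)^2 - M x) + 2 * (-3) * x * (x - 1) * L x + ((-3)^2 - (-3)) * x^2) / 2)"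
  define l where "l = (3 + 5*q + 11*q^2 + 4*q^3 + 7*q^4 + q^5 - q^6) / ((1 - q) * (1 + q) * (1 + q + q^2) * (1 + q^2))"
  define l1 where "l1 = - ((5 + 16*q + 45*q^2 + 75*q^3 + 108*q^4 + 117*q^5 + 108*q^6 + 75*q^7 + 45*q^8 + 16*q^9 + 5*q^10) * q / ((1 - q)^2 * (1 + q)^2 * (1 + q + q^2)^2 * (1 + q^2)^2))"
  define m where "m = (3 + 18*q + 51*q^2 + 110*q^3 + 169*q^4 + 220*q^5 + 222*q^6 + 196*q^7 + 127*q^8 + 78*q^9 + 25*q^10 + 10*q^11 + q^12) / ((1 - q)^2 * (1 + q)^2 * (1 + q + q^2)^2 * (1 + q^2)^2)"
  define a where "a = (1 + 4*q + 2*q^2 + 5*q^3 + 2*q^4 + q^5) * q / ((1 - q) * (1 + q) * (1 + q + q^2) * (1 + q^2))"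
  define b where "b = (3 + 2*q + 4*q^2 - 4*q^3 - 8*q^4 - 16*q^5 - 17*q^6 - 14*q^7 - 10*q^8 - 4*q^9 - q^10) * q^2 / ((1 - q)^2 * (1 + q)^2 * (1 + q + q^2)^2 * (1 + q^2)^2)"
  define v where "v = (1 - q) * (1 + q) * (1 + q + q^2) / ((1 + q^2))"
  have l_1: "L 1 = l"
    unfolding L_def l_def ell1b_def ell0_def by simp (simp only: clear_denominators mult_1_right power_one field_nonzero, algebra)
  have m_1: "M 1 = m"
    unfolding M_def m_def ell2b_def ell0'_def
    by simp (simp only: clear_denominators mult_1_right power_one field_nonzero, algebra)
  have an: "L analytic_on {1}" "M analytic_on {1}"
    unfolding L_def M_def by (intro analytic_intros; use field_nonzero in force)+
  have "(L has_field_derivative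
      - 2 * (q / (1 - q * 1)^2) - 3 * (q^3 / (1 - q^3 * 1)^2) + q^4 / (1 - q^4 * 1)^2
      + 3 * (q^2 / (1 - q^2 * 1)^2) + 3 * (- q / (1 - q)^2) - (- (q^2) / (1 - q^2)^2)) (at 1)"
  proof -
    have 1: "((\<lambda>x. \<beta> * x / (1 - \<beta> * x)) has_field_derivative \<beta> / (1 - \<beta> * 1)^2) (at 1)"
      if "1 - \<beta> \<noteq> 0" for \<beta> :: complex
      using that by (auto intro!: derivative_eq_intros simp: power2_eq_square algebra_simps)
    have 2: "((\<lambda>x. x / (x - \<gamma>)) has_field_derivative - \<gamma> / (1 - \<gamma>)^2) (at 1)"
      if "1 - \<gamma> \<noteq> 0" for \<gamma> :: complex
      using that by (auto intro!: derivative_eq_intros simp: power2_eq_square algebra_simps)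
    have 0: "((\<lambda>x. ell0 q) has_field_derivative 0) (at 1)"
      by simp
    show ?thesis
      unfolding L_def ell1b_def
      using DERIV_diff[OF DERIV_add[OF DERIV_add[OF DERIV_add[OF DERIV_diff[OF DERIV_diff[OF 0
        DERIV_cmult[OF 1[of q], of 2]] DERIV_cmult[OF 1[of "q^3"], of 3]] 1[of "q^4"]]
        DERIV_cmult[OF 1[of "q^2"], of 3]] DERIV_cmult[OF 2[of q], of 3]] 2[of "q^2"]]
      using power_nonzero by simp
  qed
  moreover have "- 2 * (q / (1 - q * 1)^2) - 3 * (q^3 / (1 - q^3 * 1)^2) + q^4 / (1 - q^4 * 1)^2
      + 3 * (q^2 / (1 - q^2 * 1)^2) + 3 * (- q / (1 - q)^2) - (- (q^2) / (1 - q^2)^2) = l1"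
    unfolding l1_def by (simp only: clear_denominators mult_1_right power_one field_nonzero, algebra)
  ultimately have "(L has_field_derivative l1) (at 1)"
    by simp
  then obtain l2 where jL: "jet L 1 l l1 l2"
    using jet_of_derivative[OF an(1)] l_1 by blast
  obtain m1 m2 where jM: "jet M 1 m m1 m2"
    using jet_of_derivative[OF an(2)] an m_1
    by (metis analytic_on_imp_differentiable_at insertI1 field_differentiable_derivI)
  have jN: "jet N 1 6 (-3 * l + 12) ((l^2 - m) / 2 - 3 * (l + l1) + 6)"
    unfolding N_def by (rule jet_eq[OF jet_quadratic[OF jL jM]]) auto
  have nz: "1 - q^3 * 1 \<noteq> 0" "1 - q^2 \<noteq> 0" "1 - q^4 * 1 \<noteq> 0" "1 - q^3 \<noteq> 0" "1 - q * 1 \<noteq> 0" "1 \<noteq> (0::complex)"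
    using field_nonzero by auto
  have "logjet \<Phi> 1 v a b"
    unfolding \<Phi>_def
    apply (rule logjet_eq, (rule logjet_intros nz no_zero_divisors power_not_zero)+)
    subgoal
      unfolding v_def by (simp only: clear_denominators mult_1_right power_one field_nonzero, algebra)
    subgoal
      unfolding a_def of_nat_numeral
      by (simp only: clear_denominators mult_1_right power_one field_nonzero, algebra)
    subgoal
      unfolding b_def of_nat_numeral
      by (simp only: clear_denominators mult_1_right power_one field_nonzero, algebra)
    done
  then have "jet \<Phi> 1 v (v * a) (v * (a^2 - b) / 2)"
    unfolding logjet_def by simp
  note j = jet_mult[OF jet_const[of cA] jet_mult[OF this jN]]
  have "residue (\<lambda>x. S x * resA q x / x) 1 = cA * (v * ((l^2 - m) / 2 - 3 * (l + l1) + 6)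
     + v * a * (-3 * l + 12) + v * (a^2 - b) / 2 * 6)"
  proof (rule trans[OF residue_pole3[OF j finite_exceptional]])
    fix x assume x: "x \<notin> exceptional"
    have "(ell1 q x)^2 - ell2 q x = 2 * N x / (x - 1)^2"
    proof -
      have "ell1 q x = L x + (-3) * (x / (x - 1))" "ell2 q x = M x + (-3) * (x / (x - 1))^2"
        by (simp_all add: ell1_eq ell2_eq L_def M_def)
      then show ?thesis
        unfolding N_def by (simp only:) (rule pole_split, use exceptional_nonzero[OF x] in auto)
    qed
    moreover have arith: "c * (D / (E * y * F * G * x)) * (2 * n / y^2) / 2 = c * (D / (E * F * G * x) * n) / y^3"
      for c D E F G n y :: complex
      by (simp add: power2_eq_square power3_eq_cube mult_ac)
    ultimately show "S x * resA q x / x = cA * (\<Phi> x * N x) / (x - 1)^3"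
      unfolding outerA_eq[OF x] \<Phi>_def by (simp only:)
  qed simp
  also have "\<dots> = - ((12 + 32*q + 78*q^2 + 108*q^3 + 140*q^4 + 108*q^5 + 78*q^6 + 32*q^7 + 12*q^8) * (1 - q)^2 * (1 + q + q^2)^2 / (q * (1 + q)^6 * (1 + q^2)^3))"
    unfolding a_def b_def v_def l_def l1_def m_def cA_def by (simp only: clear_denominators mult_1_right power_one field_nonzero, algebra)
  finally show ?thesis .
qed

section \<open>Closed forms of the residues and their sum\<close>

lemma residue_closed_forms:
  "q * cA * ((ell0 q)^2 - ell0' q) / 2 = (2 + 5*q + 15*q^2 + 22*q^3 + 37*q^4 + 33*q^5 + 37*q^6 + 22*q^7 + 15*q^8 + 5*q^9 + 2*q^10) * (1 - q) * (1 + q + q^2) / ((1 + q)^7 * (1 + q^2)^3)"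
  "cB = - ((1 - q) * (1 + q + q^2) * (1 + q + q^2 + q^3 + q^4)^3 / ((1 + q)^7 * (1 + q^2)^3 * (1 - q + q^2)))"
  "cA * (- (q * (1 - q) * (1 + q) * (1 + q + q^2) * (1 - q + q^2)^2 / ((1 + q^2) * (1 + q + q^2 + q^3 + q^4 + q^5 + q^6)))) * (gam1^2 - gam2) / 2 = - ((1 + 5*q + 18*q^2 + 50*q^3 + 118*q^4 + 241*q^5 + 449*q^6 + 762*q^7 + 1211*q^8 + 1788*q^9 + 2495*q^10 + 3275*q^11 + 4090*q^12 + 4840*q^13 + 5463*q^14 + 5857*q^15 + 6006*q^16 + 5857*q^17 + 5463*q^18 + 4840*q^19 + 4090*q^20 + 3275*q^21 + 2495*q^22 + 1788*q^23 + 1211*q^24 + 762*q^25 + 449*q^26 + 241*q^27 + 118*q^28 + 50*q^29 + 18*q^30 + 5*q^31 + q^32) * (1 - q)^2 * (1 + q + q^2)^2 / ((1 + q)^6 * (1 + q^2)^3 * (1 + q + q^2 + q^3 + q^4)^2 * (1 + q + q^2 + q^3 + q^4 + q^5 + q^6)^3))"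
  "cB * (- (q * (1 - q)^3 * (1 + q)^3 * (1 + q + q^2)^3 * (1 + q^2) * (1 - q + q^2)^3 / ((1 + q + q^2 + q^3 + q^4)^3 * (1 + q + q^2 + q^3 + q^4 + q^5 + q^6)))) * (gam1^2 - gam2) / (2 * q^2) = - ((1 + 5*q + 18*q^2 + 50*q^3 + 118*q^4 + 241*q^5 + 449*q^6 + 762*q^7 + 1211*q^8 + 1788*q^9 + 2495*q^10 + 3275*q^11 + 4090*q^12 + 4840*q^13 + 5463*q^14 + 5857*q^15 + 6006*q^16 + 5857*q^17 + 5463*q^18 + 4840*q^19 + 4090*q^20 + 3275*q^21 + 2495*q^22 + 1788*q^23 + 1211*q^24 + 762*q^25 + 449*q^26 + 241*q^27 + 118*q^28 + 50*q^29 + 18*q^30 + 5*q^31 + q^32) * (1 - q)^2 * (1 + q + q^2)^2 / ((1 + q)^6 * (1 + q^2)^3 * (1 + q + q^2 + q^3 + q^4)^2 * (1 + q + q^2 + q^3 + q^4 + q^5 + q^6)^3))"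
  \<comment> \<open>The third and fourth values coincide. Both belong to w = q^4, with (x, w/x)
    equal to (q^3, q) and (q, q^3) respectively, and the substitution of w/x for x, which preserves
    S(x) S(w) S(w/x), exchanges these points.\<close>
  unfolding cA_def cB_def ell0_def ell0'_def gam1_def gam2_def
  by (simp only: clear_denominators field_nonzero, algebra)+

lemma double_integral_value:
  "contour_integral (circlepath 0 1) (\<lambda>x. contour_integral (circlepath 0 1) (\<lambda>w. S x * (S w * S (w / x) / w) / x))
   = (2 * of_real pi * \<i>)^2 * (1
      + 3 * ((2 + 5*q + 15*q^2 + 22*q^3 + 37*q^4 + 33*q^5 + 37*q^6 + 22*q^7 + 15*q^8 + 5*q^9 + 2*q^10) * (1 - q) * (1 + q + q^2) / ((1 + q)^7 * (1 + q^2)^3))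
      + 3 * (- ((1 - q) * (1 + q + q^2) * (1 + q + q^2 + q^3 + q^4)^3 / ((1 + q)^7 * (1 + q^2)^3 * (1 - q + q^2))))
      + 2 * ((6 + 12*q + 12*q^3 + 6*q^4) * (1 - q)^2 * (1 + q + q^2)^5 / (q * (1 + q)^6 * (1 + q + q^2 + q^3 + q^4)^2))
      + 4 * (- ((1 + 5*q + 18*q^2 + 50*q^3 + 118*q^4 + 241*q^5 + 449*q^6 + 762*q^7 + 1211*q^8 + 1788*q^9 + 2495*q^10 + 3275*q^11 + 4090*q^12 + 4840*q^13 + 5463*q^14 + 5857*q^15 + 6006*q^16 + 5857*q^17 + 5463*q^18 + 4840*q^19 + 4090*q^20 + 3275*q^21 + 2495*q^22 + 1788*q^23 + 1211*q^24 + 762*q^25 + 449*q^26 + 241*q^27 + 118*q^28 + 50*q^29 + 18*q^30 + 5*q^31 + q^32) * (1 - q)^2 * (1 + q + q^2)^2 / ((1 + q)^6 * (1 + q^2)^3 * (1 + q + q^2 + q^3 + q^4)^2 * (1 + q + q^2 + q^3 + q^4 + q^5 + q^6)^3)))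
      + 2 * ((1 - q)^2 * (1 + q + q^2)^2 * (1 + q + q^2 + q^3 + q^4)^3 * (1 + q^4)^3 / ((1 + q)^6 * (1 + q + q^2 + q^3 + q^4 + q^5 + q^6)^3 * (1 + q^3 + q^6)))
      + (- ((12 + 32*q + 78*q^2 + 108*q^3 + 140*q^4 + 108*q^5 + 78*q^6 + 32*q^7 + 12*q^8) * (1 - q)^2 * (1 + q + q^2)^2 / (q * (1 + q)^6 * (1 + q^2)^3))))"
proof -
  have d: "q \<noteq> q^2" "q \<noteq> q^3" "q^2 \<noteq> q^3"
    using q_power_eq_iff[of 1 2] q_power_eq_iff[of 1 3] q_power_eq_iff[of 2 3] by auto
  have sums: "(\<Sum>p\<in>{0, q, q^3}. f p) = f 0 + f q + f (q^3)"
    "(\<Sum>p\<in>{0, q, q^2, q^3}. f p) = f 0 + f q + f (q^2) + f (q^3)" for f :: "complex \<Rightarrow> complex"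
    using d q_nonzero by (simp_all add: add.assoc)
  \<comment> \<open>The coefficients 3 are 1 + 2: a and b occur in the residues of S(x)/x and, with
    weight 2, at x = 0 of the other two integrands. The coefficient 4 is 2 + 2 from the two
    coinciding values g.\<close>
  have arith: "1 + a + b + 2 * (a + al + 0 + g) + r + 2 * (b + g + d) + 0
      = 1 + 3 * a + 3 * b + 2 * al + 4 * g + 2 * d + r" for a b al g d r :: complex
    by simp
  show ?thesis
    unfolding double_integral sums residue_outer0_0 residue_outer0_q residue_outer0_q3
      residue_outerA_0 residue_outerA_q residue_outerA_q2 residue_outerA_q3 residue_outerA_1
      residue_outerB_0 residue_outerB_q residue_outerB_q3 residue_outerB_1
      residue_closed_forms(1,3,4)
    unfolding residue_closed_forms(2) arith ..
qed

end

subsection \<open>The torus integral\<close>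

text \<open>For nonzero c, integrability passes in both directions, and without it both sides take
  the default value 0.\<close>

lemma contour_integral_cmult:
  "contour_integral g (\<lambda>x. c * f x) = c * contour_integral g f"
proof (cases "c = 0 \<or> f contour_integrable_on g")
  case True
  then show ?thesis
    by (auto simp: contour_integral_lmul)
next
  case False
  have "\<not> (\<lambda>x. c * f x) contour_integrable_on g"
  proof
    assume "(\<lambda>x. c * f x) contour_integrable_on g"
    then have "(\<lambda>x. inverse c * (c * f x)) contour_integrable_on g"
      by (rule contour_integrable_lmul)
    with False show False
      by (simp add: mult.assoc[symmetric])
  qed
  with False show ?thesis
    by (simp add: not_integrable_contour_integral)
qed

lemma prod_pairs_3:
  "(\<Prod>(i, j)\<in>{(i, j). i \<in> {1..3::nat} \<and> j \<in> {1..3} \<and> i \<noteq> j}. f i j :: complex)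
    = (f 1 2 * f 2 1) * (f 1 3 * f 3 1) * (f 2 3 * f 3 2)"
proof -
  have "{(i, j). i \<in> {1..3::nat} \<and> j \<in> {1..3} \<and> i \<noteq> j} = {(1,2), (2,1), (1,3), (3,1), (2,3), (3,2)}"
    by auto
  then show ?thesis
    by (simp add: mult.assoc)
qed

lemma bmn_index_3:
  "bmn_index 3 q q q = (bmn_kappa q q q)^2 / 6 / (2 * of_real pi * \<i>)^2 *
     contour_integral (circlepath 0 1) (\<lambda>x. contour_integral (circlepath 0 1)
       (\<lambda>w. sym_factor q x * (sym_factor q w * sym_factor q (w / x) / w) / x))"
proof -
  let ?C = "circlepath 0 1"
  let ?c = "2 * of_real pi * \<i> :: complex"
  let ?S = "sym_factor q"
  define K where "K = (\<lambda>x w. ?S x * (?S w * ?S (w / x) / w) / x)"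
  define G where "G = (\<lambda>u v w. 1 / ?c^3 / (u * v * w) * (?S (v / u) * ?S (w / u) * ?S (w / v)))"
  have pair: "bmn_factor q q q (x / y) * bmn_factor q q q (y / x) = ?S (y / x)" if "x \<noteq> 0" "y \<noteq> 0" for x y
    using bmn_factor_pair[of "y / x" q] that by (simp add: mult.commute)
  have "torus_integral 3 (\<lambda>z. (\<Prod>i\<in>{1..3}. 1 / (2 * of_real pi * \<i> * z i)) *
       (\<Prod>(i, j)\<in>{(i, j). i \<in> {1..3} \<and> j \<in> {1..3} \<and> i \<noteq> j}. bmn_factor q q q (z i / z j)))
    = contour_integral ?C (\<lambda>u. contour_integral ?C (\<lambda>v. contour_integral ?C (\<lambda>w.
        (1 / (?c * u) * (1 / (?c * v)) * (1 / (?c * w))) *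
        ((bmn_factor q q q (u / v) * bmn_factor q q q (v / u)) * (bmn_factor q q q (u / w) * bmn_factor q q q (w / u))
         * (bmn_factor q q q (v / w) * bmn_factor q q q (w / v))))))"
  proof -
    have "{1..3::nat} = {1, 2, 3}"
      by auto
    then have p: "(\<Prod>i\<in>{1..3::nat}. f i) = f 1 * f 2 * f 3" for f :: "nat \<Rightarrow> complex"
      by (simp add: mult.assoc)
    show ?thesis
      unfolding prod_pairs_3 p by (simp add: numeral_3_eq_3 numeral_2_eq_2)
  qed
  also have "\<dots> = contour_integral ?C (\<lambda>u. contour_integral ?C (\<lambda>v. contour_integral ?C (\<lambda>w. G u v w)))"
  proof (intro contour_integral_circlepath_cong)
    fix u v w :: complex
    assume "norm u = 1" "norm v = 1" "norm w = 1"
    then have "u \<noteq> 0" "v \<noteq> 0" "w \<noteq> 0"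
      by auto
    then show "(1 / (?c * u) * (1 / (?c * v)) * (1 / (?c * w))) *
        ((bmn_factor q q q (u / v) * bmn_factor q q q (v / u)) * (bmn_factor q q q (u / w) * bmn_factor q q q (w / u))
         * (bmn_factor q q q (v / w) * bmn_factor q q q (w / v))) = G u v w"
      unfolding G_def by (simp add: pair power3_eq_cube)
  qed auto
  also have "\<dots> = contour_integral ?C (\<lambda>u. (1 / ?c^3 * contour_integral ?C (\<lambda>x. contour_integral ?C (K x))) * (1 / (u - 0)))"
  proof (intro contour_integral_circlepath_cong)
    fix u :: complex assume u: "norm u = 1"
    then have u0: "u \<noteq> 0"
      by auto
    \<comment> \<open>Two rotations by u substitute v = u x and then u w for w; homogeneity leaves a
      multiple of 1/u, whose integral is 2 pi i.\<close>
    have "contour_integral ?C (\<lambda>v. contour_integral ?C (\<lambda>w. G u v w))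
       = contour_integral ?C (\<lambda>x. u * contour_integral ?C (\<lambda>w. G u (u * x) w))"
      by (rule contour_integral_circlepath_rotate[OF u])
    also have "\<dots> = contour_integral ?C (\<lambda>x. u * contour_integral ?C (\<lambda>w. u * G u (u * x) (u * w)))"
      by (subst contour_integral_circlepath_rotate[OF u]) (rule refl)
    also have "\<dots> = contour_integral ?C (\<lambda>x. u * contour_integral ?C (\<lambda>w. (1 / ?c^3 / u^2) * K x w))"
    proof (intro contour_integral_circlepath_cong arg_cong[where f = "\<lambda>z. u * z"])
      fix x w :: complex
      assume "norm x = 1" "norm w = 1"
      then have "x \<noteq> 0" "w \<noteq> 0"
        by auto
      then show "u * G u (u * x) (u * w) = (1 / ?c^3 / u^2) * K x w"
        unfolding G_def K_def using u0 by (simp add: power2_eq_square mult_ac)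
    qed auto
    also have "\<dots> = (1 / ?c^3 / u) * contour_integral ?C (\<lambda>x. contour_integral ?C (K x))"
      unfolding contour_integral_cmult using u0 by (simp add: power2_eq_square)
    finally show "contour_integral ?C (\<lambda>v. contour_integral ?C (\<lambda>w. G u v w))
      = (1 / ?c^3 * contour_integral ?C (\<lambda>x. contour_integral ?C (K x))) * (1 / (u - 0))"
      by simp
  qed auto
  also have "\<dots> = (1 / ?c^3 * contour_integral ?C (\<lambda>x. contour_integral ?C (K x))) * ?c"
    unfolding contour_integral_cmult by (subst contour_integral_circlepath) auto
  also have "\<dots> = 1 / ?c^2 * contour_integral ?C (\<lambda>x. contour_integral ?C (K x))"
  proof -
    have "(1 / c^3 * I) * c = 1 / c^2 * I" if "c \<noteq> 0" for c I :: complex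
      using that by (simp add: power2_eq_square power3_eq_cube)
    then show ?thesis
      by simp
  qed
  finally show ?thesis
    unfolding bmn_index_def K_def by (simp add: fact_numeral)
qed

text \<open>At zero fugacity the integrand is the Weyl density, so the value 1 is the normalisation
  of Haar measure: the constant term of the product of all 1 - z_i/z_j is 3! = 6.\<close>

lemma bmn_index_3_zero: "bmn_index 3 0 0 0 = 1"
proof -
  let ?C = "circlepath 0 1"
  let ?c = "2 * of_real pi * \<i> :: complex"
  let ?S = "sym_factor 0"
  have S: "?S u = - ((1 - u)^2 / u)" if "u \<noteq> 0" for u
    using that by (simp add: sym_factor_def power2_eq_square power3_eq_cube)
  have sq: "jet (\<lambda>w. (a + (-1) * w) * (a + (-1) * w)) 0 (a^2) (-2 * a) 1" for a
    by (rule jet_eq[OF jet_mult[OF jet_linear jet_linear]]) (auto simp: power2_eq_square)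
  have int: "contour_integral ?C f = ?c * a2"
    if "jet g 0 a0 a1 a2" "\<And>w. w \<noteq> 0 \<Longrightarrow> f w = g w / (w - 0)^3" "f holomorphic_on - {0}" for f g a0 a1 a2
  proof -
    have "contour_integral ?C f = ?c * (\<Sum>p\<in>{0}. residue f p)"
      by (rule circlepath_residues[of 1 2]) (use that(3) in \<open>auto elim!: holomorphic_on_subset\<close>)
    then show ?thesis
      using residue_pole3[OF that(1), of "{0}" f] that(2) by simp
  qed
  have inner: "contour_integral ?C (\<lambda>w. ?S x * (?S w * ?S (w / x) / w) / x)
     = - (?c * ((1 - x)^2 * (1 + 4 * x + x^2) / x^3))" if "norm x = 1" for x
  proof -
    have x0: "x \<noteq> 0"
      using that by auto
    have "contour_integral ?C (\<lambda>w. ?S x * (?S w * ?S (w / x) / w) / x)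
      = contour_integral ?C (\<lambda>w. - ((1 - x)^2 / x^3) * ((1 - w)^2 * (x - w)^2 / w^3))"
    proof (rule contour_integral_circlepath_cong)
      fix w :: complex assume "norm w = 1"
      then have "w \<noteq> 0"
        by auto
      then show "?S x * (?S w * ?S (w / x) / w) / x = - ((1 - x)^2 / x^3) * ((1 - w)^2 * (x - w)^2 / w^3)"
        using x0 by (simp add: S) (simp add: field_simps power2_eq_square power3_eq_cube)
    qed auto
    also have "\<dots> = - ((1 - x)^2 / x^3) * contour_integral ?C (\<lambda>w. (1 - w)^2 * (x - w)^2 / w^3)"
      by (rule contour_integral_cmult)
    also have "contour_integral ?C (\<lambda>w. (1 - w)^2 * (x - w)^2 / w^3) = ?c * (1 + 4 * x + x^2)"
      by (rule int, rule jet_eq[OF jet_mult[OF sq[of 1] sq[of x]]])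
         (auto simp: power2_eq_square intro!: holomorphic_intros)
    finally show ?thesis
      by simp
  qed
  have "contour_integral ?C (\<lambda>x. contour_integral ?C (\<lambda>w. ?S x * (?S w * ?S (w / x) / w) / x))
     = contour_integral ?C (\<lambda>x. - ?c * ((1 - x)^2 * (1 + 4 * x + x^2) / x^3))"
    unfolding minus_mult_left[symmetric] by (rule contour_integral_circlepath_cong[OF inner]) simp_all
  also have "\<dots> = - ?c * contour_integral ?C (\<lambda>x. (1 - x)^2 * (1 + 4 * x + x^2) / x^3)"
    by (rule contour_integral_cmult)
  also have "contour_integral ?C (\<lambda>x. (1 - x)^2 * (1 + 4 * x + x^2) / x^3) = ?c * (- 6)"
  proof (rule int)
    have "jet (\<lambda>x. 1 + x * (4 + 1 * x)) 0 1 4 1"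
      by (rule jet_eq[OF jet_add[OF jet_const jet_mult[OF jet_linear[of 0 1, simplified] jet_linear]]]) auto
    from jet_mult[OF sq[of 1] this]
    show "jet (\<lambda>x. ((1 + (-1) * x) * (1 + (-1) * x)) * (1 + x * (4 + 1 * x))) 0 1 2 (-6)"
      by (rule jet_eq) auto
  qed (auto simp: power2_eq_square algebra_simps intro!: holomorphic_intros)
  finally have eq: "contour_integral ?C (\<lambda>x. contour_integral ?C (\<lambda>w. ?S x * (?S w * ?S (w / x) / w) / x))
    = - ?c * (?c * (- 6))" .
  have "bmn_index 3 0 0 0 = 1 / 6 / ?c^2 * (- ?c * (?c * (- 6)))"
    unfolding bmn_index_3 eq by (simp add: bmn_kappa_def)
  also have "\<dots> = 1"
  proof -
    have *: "1 / 6 / c^2 * (- c * (c * (- 6))) = 1" if "c \<noteq> 0" for c :: complex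
      using that by (simp add: power2_eq_square)
    show ?thesis
      by (rule *) simp
  qed
  finally show ?thesis .
qed

text \<open>Here \<open>x = q\<close>, \<open>c\<^sub>1 = 1 - q\<close> and \<open>c\<^sub>k\<close> is the value at \<open>q\<close> of the \<open>k\<close>-th cyclotomic polynomial.\<close>

lemma common_denominator:
  fixes x c1 c2 c3 c4 c5 c6 c7 c8 c9 A B G R p :: complex
  assumes "x * c2^7 * c4^3 * c5^2 * c6 * c7^3 * c9
      + 3 * A * c1 * c3 * x * c5^2 * c6 * c7^3 * c9
      - 3 * c1 * c3 * c5^5 * x * c7^3 * c9
      + 2 * B * c1^2 * c3^5 * c2 * c4^3 * c6 * c7^3 * c9
      - 4 * G * c1^2 * c3^2 * x * c2 * c6 * c9
      + 2 * c1^2 * c3^2 * c5^5 * c8^3 * x * c2 * c4^3 * c6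
      - R * c1^2 * c3^2 * c2 * c5^2 * c6 * c7^3 * c9 = 6 * x * p" (is "?N = _")
    and nz: "x \<noteq> 0" "c1 \<noteq> 0" "c2 \<noteq> 0" "c3 \<noteq> 0" "c4 \<noteq> 0" "c5 \<noteq> 0" "c6 \<noteq> 0" "c7 \<noteq> 0" "c9 \<noteq> 0"
  shows "(c2^3 / (c1 * c3))^2 / 6 * (1
      + 3 * (A * c1 * c3 / (c2^7 * c4^3))
      + 3 * (- (c1 * c3 * c5^3 / (c2^7 * c4^3 * c6)))
      + 2 * (B * c1^2 * c3^5 / (x * c2^6 * c5^2))
      + 4 * (- (G * c1^2 * c3^2 / (c2^6 * c4^3 * c5^2 * c7^3)))
      + 2 * (c1^2 * c3^2 * c5^3 * c8^3 / (c2^6 * c7^3 * c9))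
      + (- (R * c1^2 * c3^2 / (x * c2^6 * c4^3))))
    = p * (c1^5 * (c1 * c2)^3 / ((c1 * c2 * c4)^3 * (c1 * c5)^2 * (c1 * c2 * c3 * c6) *
        (c1 * c7)^3 * (c1 * c3 * c9)))"
proof -
  \<comment> \<open>With p eliminated, the goal is an identity of rational functions in independent
    letters, so no cyclotomic polynomial is expanded here.\<close>
  have "p = ?N / (6 * x)"
    using assms(1) nz(1) by (simp add: field_simps)
  then show ?thesis
    by (simp only: clear_denominators nz, algebra)
qed

section \<open>Assembly over the common denominator\<close>

context fugacity
begin

lemma bmn_index_3_fugacity:
  "bmn_index 3 q q q = (1 + 5*q + 24*q^2 + 82*q^3 + 245*q^4 + 628*q^5 + 1444*q^6 + 3013*q^7 + 5806*q^8 + 10431*q^9 + 17628*q^10 + 28174*q^11 + 42820*q^12 + 62104*q^13 + 86268*q^14 + 115035*q^15 + 147595*q^16 + 182506*q^17 + 217831*q^18 + 251223*q^19 + 280233*q^20 + 302516*q^21 + 316224*q^22 + 320131*q^23 + 313920*q^24 + 298116*q^25 + 274103*q^26 + 243875*q^27 + 209819*q^28 + 174384*q^29 + 139852*q^30 + 108049*q^31 + 80282*q^32 + 57228*q^33 + 39035*q^34 + 25393*q^35 + 15687*q^36 + 9153*q^37 + 5013*q^38 + 2553*q^39 + 1197*q^40 + 507*q^41 + 189*q^42 + 60*q^43 + 15*q^44 + 3*q^45)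
    * ((1 - q)^5 * (1 - q^2)^3 /
       ((1 - q^4)^3 * (1 - q^5)^2 * (1 - q^6) * (1 - q^7)^3 * (1 - q^9)))"
proof -
  have kappa: "bmn_kappa q q q = (1 + q)^3 / ((1 - q) * (1 + q + q^2))"
  proof -
    have "bmn_kappa q q q = (1 - q^2)^3 / ((1 - q^3) * (1 - q)^3)"
      by (simp add: bmn_kappa_def power2_eq_square power3_eq_cube mult.assoc)
    also have "\<dots> = (1 + q)^3 / ((1 - q) * (1 + q + q^2))"
      by (simp only: clear_denominators field_nonzero, algebra)
    finally show ?thesis .
  qed
  have factors: "1 - q^2 = (1 - q) * (1 + q)"
    "1 - q^4 = (1 - q) * (1 + q) * (1 + q^2)" "1 - q^5 = (1 - q) * (1 + q + q^2 + q^3 + q^4)"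
    "1 - q^6 = (1 - q) * (1 + q) * (1 + q + q^2) * (1 - q + q^2)"
    "1 - q^7 = (1 - q) * (1 + q + q^2 + q^3 + q^4 + q^5 + q^6)"
    "1 - q^9 = (1 - q) * (1 + q + q^2) * (1 + q^3 + q^6)"
    by algebra+
  have "bmn_index 3 q q q = ((1 + q)^3 / ((1 - q) * (1 + q + q^2)))^2 / 6 * (1
      + 3 * ((2 + 5*q + 15*q^2 + 22*q^3 + 37*q^4 + 33*q^5 + 37*q^6 + 22*q^7 + 15*q^8 + 5*q^9 + 2*q^10) * (1 - q) * (1 + q + q^2) / ((1 + q)^7 * (1 + q^2)^3))
      + 3 * (- ((1 - q) * (1 + q + q^2) * (1 + q + q^2 + q^3 + q^4)^3 / ((1 + q)^7 * (1 + q^2)^3 * (1 - q + q^2))))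
      + 2 * ((6 + 12*q + 12*q^3 + 6*q^4) * (1 - q)^2 * (1 + q + q^2)^5 / (q * (1 + q)^6 * (1 + q + q^2 + q^3 + q^4)^2))
      + 4 * (- ((1 + 5*q + 18*q^2 + 50*q^3 + 118*q^4 + 241*q^5 + 449*q^6 + 762*q^7 + 1211*q^8 + 1788*q^9 + 2495*q^10 + 3275*q^11 + 4090*q^12 + 4840*q^13 + 5463*q^14 + 5857*q^15 + 6006*q^16 + 5857*q^17 + 5463*q^18 + 4840*q^19 + 4090*q^20 + 3275*q^21 + 2495*q^22 + 1788*q^23 + 1211*q^24 + 762*q^25 + 449*q^26 + 241*q^27 + 118*q^28 + 50*q^29 + 18*q^30 + 5*q^31 + q^32) * (1 - q)^2 * (1 + q + q^2)^2 / ((1 + q)^6 * (1 + q^2)^3 * (1 + q + q^2 + q^3 + q^4)^2 * (1 + q + q^2 + q^3 + q^4 + q^5 + q^6)^3)))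
      + 2 * ((1 - q)^2 * (1 + q + q^2)^2 * (1 + q + q^2 + q^3 + q^4)^3 * (1 + q^4)^3 / ((1 + q)^6 * (1 + q + q^2 + q^3 + q^4 + q^5 + q^6)^3 * (1 + q^3 + q^6)))
      + (- ((12 + 32*q + 78*q^2 + 108*q^3 + 140*q^4 + 108*q^5 + 78*q^6 + 32*q^7 + 12*q^8) * (1 - q)^2 * (1 + q + q^2)^2 / (q * (1 + q)^6 * (1 + q^2)^3))))"
    unfolding bmn_index_3 double_integral_value kappa by simp
  also have "\<dots> = (1 + 5*q + 24*q^2 + 82*q^3 + 245*q^4 + 628*q^5 + 1444*q^6 + 3013*q^7 + 5806*q^8 + 10431*q^9 + 17628*q^10 + 28174*q^11 + 42820*q^12 + 62104*q^13 + 86268*q^14 + 115035*q^15 + 147595*q^16 + 182506*q^17 + 217831*q^18 + 251223*q^19 + 280233*q^20 + 302516*q^21 + 316224*q^22 + 320131*q^23 + 313920*q^24 + 298116*q^25 + 274103*q^26 + 243875*q^27 + 209819*q^28 + 174384*q^29 + 139852*q^30 + 108049*q^31 + 80282*q^32 + 57228*q^33 + 39035*q^34 + 25393*q^35 + 15687*q^36 + 9153*q^37 + 5013*q^38 + 2553*q^39 + 1197*q^40 + 507*q^41 + 189*q^42 + 60*q^43 + 15*q^44 + 3*q^45)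
    * ((1 - q)^5 * ((1 - q) * (1 + q))^3 /
       (((1 - q) * (1 + q) * (1 + q^2))^3 * ((1 - q) * (1 + q + q^2 + q^3 + q^4))^2 *
        ((1 - q) * (1 + q) * (1 + q + q^2) * (1 - q + q^2)) *
        ((1 - q) * (1 + q + q^2 + q^3 + q^4 + q^5 + q^6))^3 * ((1 - q) * (1 + q + q^2) * (1 + q^3 + q^6))))"
  proof (rule common_denominator)
    \<comment> \<open>The polynomial of the theorem enters as this numerator divided by 6 q: 6 comes
      from 3!, and q from the residues with a factor q in the denominator, at x = q and x =
      1.\<close>
    show "q * (1 + q)^7 * (1 + q^2)^3 * (1 + q + q^2 + q^3 + q^4)^2 * (1 - q + q^2) * (1 + q + q^2 + q^3 + q^4 + q^5 + q^6)^3 * (1 + q^3 + q^6)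
      + 3 * (2 + 5*q + 15*q^2 + 22*q^3 + 37*q^4 + 33*q^5 + 37*q^6 + 22*q^7 + 15*q^8 + 5*q^9 + 2*q^10) * (1 - q) * (1 + q + q^2) * q * (1 + q + q^2 + q^3 + q^4)^2 * (1 - q + q^2) * (1 + q + q^2 + q^3 + q^4 + q^5 + q^6)^3 * (1 + q^3 + q^6)
      - 3 * (1 - q) * (1 + q + q^2) * (1 + q + q^2 + q^3 + q^4)^5 * q * (1 + q + q^2 + q^3 + q^4 + q^5 + q^6)^3 * (1 + q^3 + q^6)
      + 2 * (6 + 12*q + 12*q^3 + 6*q^4) * (1 - q)^2 * (1 + q + q^2)^5 * (1 + q) * (1 + q^2)^3 * (1 - q + q^2) * (1 + q + q^2 + q^3 + q^4 + q^5 + q^6)^3 * (1 + q^3 + q^6)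
      - 4 * (1 + 5*q + 18*q^2 + 50*q^3 + 118*q^4 + 241*q^5 + 449*q^6 + 762*q^7 + 1211*q^8 + 1788*q^9 + 2495*q^10 + 3275*q^11 + 4090*q^12 + 4840*q^13 + 5463*q^14 + 5857*q^15 + 6006*q^16 + 5857*q^17 + 5463*q^18 + 4840*q^19 + 4090*q^20 + 3275*q^21 + 2495*q^22 + 1788*q^23 + 1211*q^24 + 762*q^25 + 449*q^26 + 241*q^27 + 118*q^28 + 50*q^29 + 18*q^30 + 5*q^31 + q^32) * (1 - q)^2 * (1 + q + q^2)^2 * q * (1 + q) * (1 - q + q^2) * (1 + q^3 + q^6)
      + 2 * (1 - q)^2 * (1 + q + q^2)^2 * (1 + q + q^2 + q^3 + q^4)^5 * (1 + q^4)^3 * q * (1 + q) * (1 + q^2)^3 * (1 - q + q^2)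
      - (12 + 32*q + 78*q^2 + 108*q^3 + 140*q^4 + 108*q^5 + 78*q^6 + 32*q^7 + 12*q^8) * (1 - q)^2 * (1 + q + q^2)^2 * (1 + q) * (1 + q + q^2 + q^3 + q^4)^2 * (1 - q + q^2) * (1 + q + q^2 + q^3 + q^4 + q^5 + q^6)^3 * (1 + q^3 + q^6)
      = 6 * q * (1 + 5*q + 24*q^2 + 82*q^3 + 245*q^4 + 628*q^5 + 1444*q^6 + 3013*q^7 + 5806*q^8 + 10431*q^9 + 17628*q^10 + 28174*q^11 + 42820*q^12 + 62104*q^13 + 86268*q^14 + 115035*q^15 + 147595*q^16 + 182506*q^17 + 217831*q^18 + 251223*q^19 + 280233*q^20 + 302516*q^21 + 316224*q^22 + 320131*q^23 + 313920*q^24 + 298116*q^25 + 274103*q^26 + 243875*q^27 + 209819*q^28 + 174384*q^29 + 139852*q^30 + 108049*q^31 + 80282*q^32 + 57228*q^33 + 39035*q^34 + 25393*q^35 + 15687*q^36 + 9153*q^37 + 5013*q^38 + 2553*q^39 + 1197*q^40 + 507*q^41 + 189*q^42 + 60*q^43 + 15*q^44 + 3*q^45)"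
      by algebra
  qed (rule field_nonzero)+
  finally show ?thesis
    unfolding factors .
qed

end

theorem mainTheorem2:
  fixes t :: complex
  assumes "norm t < 1"
  shows "bmn_index 3 (t ^ 2) (t ^ 2) (t ^ 2) =
         (1 + 5 * t ^ 2 + 24 * t ^ 4 + 82 * t ^ 6 + 245 * t ^ 8
          + 628 * t ^ 10 + 1444 * t ^ 12 + 3013 * t ^ 14 + 5806 * t ^ 16 + 10431 * t ^ 18
          + 17628 * t ^ 20 + 28174 * t ^ 22 + 42820 * t ^ 24 + 62104 * t ^ 26 + 86268 * t ^ 28
          + 115035 * t ^ 30 + 147595 * t ^ 32 + 182506 * t ^ 34 + 217831 * t ^ 36 + 251223 * t ^ 38
          + 280233 * t ^ 40 + 302516 * t ^ 42 + 316224 * t ^ 44 + 320131 * t ^ 46 + 313920 * t ^ 48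
          + 298116 * t ^ 50 + 274103 * t ^ 52 + 243875 * t ^ 54 + 209819 * t ^ 56 + 174384 * t ^ 58
          + 139852 * t ^ 60 + 108049 * t ^ 62 + 80282 * t ^ 64 + 57228 * t ^ 66 + 39035 * t ^ 68
          + 25393 * t ^ 70 + 15687 * t ^ 72 + 9153 * t ^ 74 + 5013 * t ^ 76 + 2553 * t ^ 78
          + 1197 * t ^ 80 + 507 * t ^ 82 + 189 * t ^ 84 + 60 * t ^ 86 + 15 * t ^ 88
          + 3 * t ^ 90)
         * (((1 - t ^ 2) ^ 5 * (1 - t ^ 4) ^ 3) /
            ((1 - t ^ 8) ^ 3 * (1 - t ^ 10) ^ 2 * (1 - t ^ 12) * (1 - t ^ 14) ^ 3 * (1 - t ^ 18)))"
proof (cases "t = 0")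
  case True
  then show ?thesis
    using bmn_index_3_zero by simp
next
  case False
  interpret fugacity "t ^ 2"
    using False assms by unfold_locales (auto simp: norm_power power_less_one_iff)
  show ?thesis
    using bmn_index_3_fugacity by (simp only: power_mult[symmetric] mult_2 numeral_times_numeral) simp
qed

end
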